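(* For every $\gamma>-1$, $$I_0^H\big(x^{2+2\gamma}\,C^\infty_{\mathrm{ev}}(\mathbb D_H)\big)\subset \mu_H^{2\gamma+2}\,C^\infty_{\alpha,+}(\overline{\mathcal G_H}).$$
   Context: $\mathbb D_H=\{z\in\mathbb C:|z|\le1\}$, whose interior carries the Poincaré metric $g_H=c(z)^{-2}|dz|^2$, $c(z)=(1-|z|^2)/2$. Let $x(z)=\frac{1-|z|^2}{1+|z|^2}$, a boundary defining function. $C^\infty_{\mathrm{ev}}(\mathbb D_H)$ is the space of smooth functions on $\mathbb D_H$ whose Taylor expansion off of $\partial\mathbb D_H$, written in terms of $x$ (and $\omega=\arg z$), contains only even powers of $x$. Geodesics: $\mathcal G_H=\mathbb S^1_\beta\times\mathbb R_a$ and $\gamma_{\beta,a}(t)=e^{i\beta}\frac{(2+ia)\tanh(t/2)+ia}{ia\tanh(t/2)-2+ia}$, $t\in\mathbb R$ (unit-speed $g_H$-geodesics). The hyperbolic X-ray transform is $I_0^Hf(\beta,a)=\int_{\mathbb R}f(\gamma_{\beta,a}(t))\,dt$. Let $\mu_H(\beta,a)=(1+a^2)^{-1/2}$. $\overline{\mathcal G_H}=\mathbb S^1\times[-\infty,\infty]$ has the smooth structure making $\Psi_{hf}(\beta,a)=(\beta,\tan^{-1}a)$ a diffeomorphism onto $\partial_+S\mathbb D_E=\mathbb S^1_\beta\times[-\pi/2,\pi/2]_\alpha$. Fan-beam coordinates $(\beta,\alpha)\in\mathbb S^1\times\mathbb R/2\pi\mathbb Z$ on $\partial S\mathbb D_E$: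 unit vector at $e^{i\beta}$ with direction $e^{i(\beta+\pi+\alpha)}$; $\partial_\pm S\mathbb D_E$ correspond to $\alpha\in[-\pi/2,\pi/2]$, resp. $[\pi/2,3\pi/2]$. $\mathcal S^E(\beta,\alpha)=(\beta+\pi+2\alpha,\pi-\alpha)$, $\mathcal S^E_A(\beta,\alpha)=(\beta+\pi+2\alpha,-\alpha)$; $A_+u=u$ on $\partial_+$, $u\circ\mathcal S^E$ on $\partial_-$. $C^\infty_{\alpha,+}(\partial_+S\mathbb D_E)=\{u\in C^\infty(\partial_+S\mathbb D_E):A_+u\in C^\infty(\partial S\mathbb D_E),\ u\circ\mathcal S^E_A=u\}$ and $C^\infty_{\alpha,+}(\overline{\mathcal G_H})=\Psi_{hf}^*C^\infty_{\alpha,+}(\partial_+S\mathbb D_E)$. *)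

theory Defs
  imports "HOL-Analysis.Analysis"
begin

coinductive smooth_on :: "'a::euclidean_space set \<Rightarrow> ('a \<Rightarrow> 'b::real_normed_vector) \<Rightarrow> bool" where
  "(\<forall>x\<in>S. (f has_derivative (\<lambda>h. \<Sum>i\<in>Basis. (h \<bullet> i) *\<^sub>R D i x)) (at x within S))
   \<Longrightarrow> (\<forall>i\<in>Basis. smooth_on S (D i)) \<Longrightarrow> smooth_on S f"

definition DH :: "complex set" where "DH = cball 0 1"

definition xH :: "complex \<Rightarrow> real" where
  "xH z = (1 - (cmod z)\<^sup>2) / (1 + (cmod z)\<^sup>2)"

text \<open>Inverse polar coordinates in terms of (x, omega): |z| = sqrt((1-x)/(1+x)), arg z = omega.\<close>
definition z_of_xw :: "real \<Rightarrow> real \<Rightarrow> complex" where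
  "z_of_xw x w = complex_of_real (sqrt ((1 - x) / (1 + x))) * cis w"

text \<open>C^infty_ev(D_H): smooth on the closed disk, and the Taylor expansion off the boundary
  in the variable x (at each omega) contains only even powers of x.\<close>
definition Cev :: "(complex \<Rightarrow> complex) set" where
  "Cev = {f. smooth_on DH f \<and>
     (\<forall>w N. \<exists>a :: nat \<Rightarrow> complex. (\<forall>j. odd j \<longrightarrow> a j = 0) \<and>
        ((\<lambda>x. (f (z_of_xw x w) - (\<Sum>j\<le>N. a j * complex_of_real x ^ j)) / complex_of_real x ^ N)
           \<longlongrightarrow> 0) (at_right 0))}"

text \<open>Unit speed hyperbolic geodesics gamma_{beta,a}.\<close>
definition geodH :: "real \<Rightarrow> real \<Rightarrow> real \<Rightarrow> complex" where
  "geodH \<beta> a t = cis \<beta> *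
     (((2 + \<i> * of_real a) * of_real (tanh (t/2)) + \<i> * of_real a) /
      (\<i> * of_real a * of_real (tanh (t/2)) - 2 + \<i> * of_real a))"

definition I0H :: "(complex \<Rightarrow> complex) \<Rightarrow> real \<Rightarrow> real \<Rightarrow> complex" where
  "I0H f \<beta> a = (\<integral>t. f (geodH \<beta> a t) \<partial>lborel)"

definition muH :: "real \<Rightarrow> real" where
  "muH a = 1 / sqrt (1 + a\<^sup>2)"

text \<open>Fan-beam scattering relation and antipodal scattering relation on the Euclidean disk.\<close>
definition SE :: "real \<times> real \<Rightarrow> real \<times> real" where
  "SE p = (fst p + pi + 2 * snd p, pi - snd p)"
definition SEA :: "real \<times> real \<Rightarrow> real \<times> real" where
  "SEA p = (fst p + pi + 2 * snd p, - snd p)"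

definition alpha_red :: "real \<Rightarrow> real" where
  "alpha_red \<alpha> = \<alpha> - 2 * pi * of_int \<lfloor>(\<alpha> + pi/2) / (2*pi)\<rfloor>"

text \<open>A_+ u on the full boundary dS D_E (as a 2pi-periodic function of (beta, alpha)):
  u on partial_+ (alpha in [-pi/2,pi/2]), u o S^E on partial_- (alpha in [pi/2,3pi/2]).\<close>
definition Aplus :: "(real \<times> real \<Rightarrow> complex) \<Rightarrow> real \<times> real \<Rightarrow> complex" where
  "Aplus u p = (let \<alpha> = alpha_red (snd p) in
      if \<alpha> \<le> pi/2 then u (fst p, \<alpha>) else u (SE (fst p, \<alpha>)))"

text \<open>partial_+ S D_E = S^1_beta x [-pi/2,pi/2]_alpha, with beta represented by a real, 2pi-periodically.\<close>
definition dplus :: "(real \<times> real) set" where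
  "dplus = UNIV \<times> {-pi/2 .. pi/2}"

definition Calpha_plus :: "(real \<times> real \<Rightarrow> complex) set" where
  "Calpha_plus = {u. (\<forall>\<beta> \<alpha>. u (\<beta> + 2*pi, \<alpha>) = u (\<beta>, \<alpha>))
                   \<and> smooth_on dplus u
                   \<and> smooth_on UNIV (Aplus u)
                   \<and> (\<forall>p\<in>dplus. u (SEA p) = u p)}"

definition CalphaG :: "(real \<Rightarrow> real \<Rightarrow> complex) set" where
  "CalphaG = {h. \<exists>u\<in>Calpha_plus. \<forall>\<beta> a. h \<beta> a = u (\<beta>, arctan a)}"

end

theory Submission
  imports Defs
begin

text \<open>
  A unit-speed geodesic, reparametrised by \<open>s = t + ln (1 + a\<^sup>2) / 2\<close> and \<open>v = 1 / (1 + exp (- s))\<close>,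
  becomes \<open>Z(\<beta>, \<alpha>, v) = e\<^bsup>i\<beta>\<^esup> ((1 - v) - v e\<^bsup>i\<alpha>\<^esup>) / ((1 - v) + v e\<^bsup>-i\<alpha>\<^esup>)\<close> with \<open>\<alpha> = arctan a\<close>, and
  \<open>x = \<mu>\<^sub>H / cosh s\<close> along it. Hence the transform of \<open>x\<^bsup>2+2\<gamma>\<^esup> g\<close> is \<open>\<mu>\<^sub>H\<^bsup>2+2\<gamma>\<^esup>\<close> times the integral of
  \<open>g(Z)\<close> against the integrable weight \<open>(1 / cosh s)\<^bsup>2+2\<gamma>\<^esup>\<close>. The inversion \<open>z \<mapsto> 1 / cnj z\<close> changes the
  sign of \<open>x\<close> and fixes \<open>\<omega>\<close>, so the evenness of \<open>g\<close> says exactly that extending \<open>g\<close> outside the disk by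
  inversion gives a smooth function near the circle. In terms of this extension the integral makes sense
  for all \<open>\<alpha>\<close>; the scattering relation turns \<open>Z(v)\<close> into the inverse point of \<open>Z(1 - v)\<close>, the antipodal
  one turns it into \<open>Z(1 - v)\<close>, and the weight is even in \<open>s\<close>. So the integral is invariant
  under both relations and equals its own extension under \<open>A\<^sub>+\<close>. It is smooth where \<open>cos \<alpha> > 0\<close> because
  there \<open>Z\<close> stays in the disk, and where \<open>sin \<alpha> > 0\<close> because there \<open>Z\<close> avoids \<open>0\<close> and has a smooth
  logarithm; the two relations carry this over to all remaining \<open>\<alpha>\<close>.
\<close>

subsection \<open>Differentiability of finite order\<close>

text \<open>Closure of the coinductive \<open>smooth_on\<close> under products or composition would
  require a separate invariant each time. At finite order the same facts follow by induction on
  \<open>n\<close>, since differentiation yields sums of products of functions of lower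
  order.\<close>

primrec Ck :: "nat \<Rightarrow> 'a::euclidean_space set \<Rightarrow> ('a \<Rightarrow> 'b::real_normed_vector) \<Rightarrow> bool" where
  "Ck 0 S f = continuous_on S f"
| "Ck (Suc n) S f = (\<exists>D. (\<forall>x\<in>S. (f has_derivative (\<lambda>h. \<Sum>i\<in>Basis. (h \<bullet> i) *\<^sub>R D i x)) (at x within S))
     \<and> (\<forall>i\<in>Basis. Ck n S (D i)))"

lemma Ck_cong:
  assumes f: "Ck n S f" and eq: "\<And>x. x \<in> S \<Longrightarrow> f x = g x"
  shows "Ck n S g"
proof (cases n)
  case 0
  then show ?thesis using f eq continuous_on_cong[of S S f g] by simp
next
  case (Suc m)
  then obtain D where D:
    "\<forall>x\<in>S. (f has_derivative (\<lambda>h. \<Sum>i\<in>Basis. (h \<bullet> i) *\<^sub>R D i x)) (at x within S)"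
    "\<forall>i\<in>Basis. Ck m S (D i)" using f by auto
  have "(g has_derivative (\<lambda>h. \<Sum>i\<in>Basis. (h \<bullet> i) *\<^sub>R D i x)) (at x within S)" if "x \<in> S" for x
    by (rule has_derivative_transform[OF that _ D(1)[rule_format, OF that]]) (simp add: eq)
  then show ?thesis using D(2) Suc by auto
qed

lemma Ck_imp_continuous_on: "Ck n S f \<Longrightarrow> continuous_on S f"
  by (cases n) (auto intro: has_derivative_continuous_on)

lemma Ck_SucD: "Ck (Suc n) S f \<Longrightarrow> Ck n S f"
proof (induction n arbitrary: f)
  case 0
  then show ?case by (auto intro: has_derivative_continuous_on)
next
  case (Suc n)
  show ?case using Suc.prems Suc.IH unfolding Ck.simps(2)[of _ S f] by blast
qed

lemma Ck_const [simp]: "Ck n S (\<lambda>x. c)"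
proof (induction n arbitrary: c)
  case (Suc n)
  then show ?case by (auto intro!: exI[of _ "\<lambda>i x. 0"])
qed simp

lemma Ck_bounded_linear_comp:
  assumes "bounded_linear L"
  shows "Ck n S f \<Longrightarrow> Ck n S (\<lambda>x. L (f x))"
proof (induction n arbitrary: f)
  case 0
  then show ?case using assms by (simp add: bounded_linear.continuous_on)
next
  case (Suc n)
  interpret bounded_linear L by fact
  from Suc.prems obtain D where D:
    "\<forall>x\<in>S. (f has_derivative (\<lambda>h. \<Sum>i\<in>Basis. (h \<bullet> i) *\<^sub>R D i x)) (at x within S)"
    "\<forall>i\<in>Basis. Ck n S (D i)" by auto
  have "((\<lambda>x. L (f x)) has_derivative (\<lambda>h. \<Sum>i\<in>Basis. (h \<bullet> i) *\<^sub>R L (D i x))) (at x within S)"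
    if "x \<in> S" for x
    using has_derivative[OF D(1)[rule_format, OF that]] by (simp add: sum scaleR)
  then show ?case using D(2) Suc.IH by (auto intro!: exI[of _ "\<lambda>i x. L (D i x)"])
qed

lemma Ck_bounded_linear:
  fixes L :: "'a::euclidean_space \<Rightarrow> 'b::real_normed_vector"
  assumes "bounded_linear L"
  shows "Ck n S L"
proof (cases n)
  case 0
  then show ?thesis using linear_continuous_on[OF assms] by simp
next
  case (Suc m)
  interpret bounded_linear L by fact
  have L: "L = (\<lambda>h. \<Sum>i\<in>Basis. (h \<bullet> i) *\<^sub>R L i)"
    by (rule ext) (metis (no_types, lifting) euclidean_representation sum scaleR sum.cong)
  have "(L has_derivative (\<lambda>h. \<Sum>i\<in>Basis. (h \<bullet> i) *\<^sub>R L i)) (at x within S)" for x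
    using bounded_linear_imp_has_derivative[OF assms, of "at x within S"] L by metis
  then show ?thesis using Suc by (auto intro!: exI[of _ "\<lambda>i x. L i"])
qed

lemma Ck_add: "Ck n S f \<Longrightarrow> Ck n S g \<Longrightarrow> Ck n S (\<lambda>x. f x + g x)"
proof (induction n arbitrary: f g)
  case 0
  then show ?case by (auto intro: continuous_on_add)
next
  case (Suc n)
  from Suc.prems obtain D E where D:
    "\<forall>x\<in>S. (f has_derivative (\<lambda>h. \<Sum>i\<in>Basis. (h \<bullet> i) *\<^sub>R D i x)) (at x within S)"
    "\<forall>i\<in>Basis. Ck n S (D i)" and E:
    "\<forall>x\<in>S. (g has_derivative (\<lambda>h. \<Sum>i\<in>Basis. (h \<bullet> i) *\<^sub>R E i x)) (at x within S)"
    "\<forall>i\<in>Basis. Ck n S (E i)" by auto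
  have "((\<lambda>x. f x + g x) has_derivative (\<lambda>h. \<Sum>i\<in>Basis. (h \<bullet> i) *\<^sub>R (D i x + E i x))) (at x within S)"
    if "x \<in> S" for x
    using has_derivative_add[OF D(1)[rule_format, OF that] E(1)[rule_format, OF that]]
    by (simp add: scaleR_add_right sum.distrib)
  then show ?case using D(2) E(2) Suc.IH by (auto intro!: exI[of _ "\<lambda>i x. D i x + E i x"])
qed

lemma Ck_sum:
  assumes "finite I" "\<And>i. i \<in> I \<Longrightarrow> Ck n S (f i)"
  shows "Ck n S (\<lambda>x. \<Sum>i\<in>I. f i x)"
  using assms by (induction I rule: finite_induct) (auto intro: Ck_add)

lemma Ck_bounded_bilinear:
  assumes "bounded_bilinear pr"
  shows "Ck n S f \<Longrightarrow> Ck n S g \<Longrightarrow> Ck n S (\<lambda>x. pr (f x) (g x))"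
proof (induction n arbitrary: f g)
  case 0
  then show ?case using assms by (simp add: bounded_bilinear.continuous_on)
next
  case (Suc n)
  interpret bounded_bilinear pr by fact
  from Suc.prems obtain D E where D:
    "\<forall>x\<in>S. (f has_derivative (\<lambda>h. \<Sum>i\<in>Basis. (h \<bullet> i) *\<^sub>R D i x)) (at x within S)"
    "\<forall>i\<in>Basis. Ck n S (D i)" and E:
    "\<forall>x\<in>S. (g has_derivative (\<lambda>h. \<Sum>i\<in>Basis. (h \<bullet> i) *\<^sub>R E i x)) (at x within S)"
    "\<forall>i\<in>Basis. Ck n S (E i)" by auto
  have "((\<lambda>x. pr (f x) (g x)) has_derivative
      (\<lambda>h. \<Sum>i\<in>Basis. (h \<bullet> i) *\<^sub>R (pr (f x) (E i x) + pr (D i x) (g x)))) (at x within S)"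
    if "x \<in> S" for x
    using FDERIV[OF D(1)[rule_format, OF that] E(1)[rule_format, OF that]]
    by (simp add: scaleR_add_right sum.distrib sum_left sum_right scaleR_left scaleR_right)
  moreover have "Ck n S f" "Ck n S g" using Suc.prems Ck_SucD by blast+
  ultimately show ?case using D(2) E(2) Suc.IH
    by (auto intro!: exI[of _ "\<lambda>i x. pr (f x) (E i x) + pr (D i x) (g x)"] Ck_add)
qed

lemma Ck_mult:
  fixes f g :: "'a::euclidean_space \<Rightarrow> 'b::real_normed_algebra"
  shows "Ck n S f \<Longrightarrow> Ck n S g \<Longrightarrow> Ck n S (\<lambda>x. f x * g x)"
  by (rule Ck_bounded_bilinear[OF bounded_bilinear_mult])

lemma Ck_uminus: "Ck n S f \<Longrightarrow> Ck n S (\<lambda>x. - f x)"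
  by (rule Ck_bounded_linear_comp[OF bounded_linear_minus[OF bounded_linear_ident]])

lemma Ck_diff: "Ck n S f \<Longrightarrow> Ck n S g \<Longrightarrow> Ck n S (\<lambda>x. f x - g x)"
  using Ck_add[OF _ Ck_uminus, of n S f g] by simp

text \<open>By the chain rule the partials are sums of products of \<open>E i x \<bullet> k\<close>
  and \<open>D k (\<phi> x)\<close>, and the induction hypothesis covers the latter. Derivatives
  within \<open>T\<close> restrict to the image of \<open>S\<close>, so neither set has to be
  open.\<close>

lemma Ck_compose:
  fixes f :: "'b::euclidean_space \<Rightarrow> 'c::real_normed_vector"
    and \<phi> :: "'a::euclidean_space \<Rightarrow> 'b"
  shows "Ck n T f \<Longrightarrow> Ck n S \<phi> \<Longrightarrow> \<phi> ` S \<subseteq> T \<Longrightarrow> Ck n S (\<lambda>x. f (\<phi> x))"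
proof (induction n arbitrary: f)
  case 0
  then show ?case by (auto intro: continuous_on_compose2)
next
  case (Suc n)
  from Suc.prems obtain D E where D:
    "\<forall>x\<in>T. (f has_derivative (\<lambda>h. \<Sum>i\<in>Basis. (h \<bullet> i) *\<^sub>R D i x)) (at x within T)"
    "\<forall>i\<in>Basis. Ck n T (D i)" and E:
    "\<forall>x\<in>S. (\<phi> has_derivative (\<lambda>h. \<Sum>i\<in>Basis. (h \<bullet> i) *\<^sub>R E i x)) (at x within S)"
    "\<forall>i\<in>Basis. Ck n S (E i)" by auto
  have "((\<lambda>x. f (\<phi> x)) has_derivative
      (\<lambda>h. \<Sum>i\<in>Basis. (h \<bullet> i) *\<^sub>R (\<Sum>k\<in>Basis. (E i x \<bullet> k) *\<^sub>R D k (\<phi> x)))) (at x within S)"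
    if x: "x \<in> S" for x
  proof -
    have "\<phi> x \<in> T" using Suc.prems(3) x by auto
    then have "(f has_derivative (\<lambda>h. \<Sum>i\<in>Basis. (h \<bullet> i) *\<^sub>R D i (\<phi> x))) (at (\<phi> x) within \<phi> ` S)"
      using D(1) Suc.prems(3) has_derivative_subset by blast
    from has_derivative_in_compose[OF E(1)[rule_format, OF x] this]
    have "((\<lambda>x. f (\<phi> x)) has_derivative
      (\<lambda>h. \<Sum>k\<in>Basis. ((\<Sum>i\<in>Basis. (h \<bullet> i) *\<^sub>R E i x) \<bullet> k) *\<^sub>R D k (\<phi> x))) (at x within S)" .
    moreover have "(\<Sum>k\<in>Basis. ((\<Sum>i\<in>Basis. (h \<bullet> i) *\<^sub>R E i x) \<bullet> k) *\<^sub>R D k (\<phi> x)) =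
      (\<Sum>i\<in>Basis. (h \<bullet> i) *\<^sub>R (\<Sum>k\<in>Basis. (E i x \<bullet> k) *\<^sub>R D k (\<phi> x)))" for h
      unfolding inner_sum_left scaleR_sum_left scaleR_sum_right
      by (subst sum.swap) simp
    ultimately show ?thesis by simp
  qed
  moreover have "Ck n S \<phi>" using Suc.prems Ck_SucD by blast
  then have "Ck n S (\<lambda>x. \<Sum>k\<in>Basis. (E i x \<bullet> k) *\<^sub>R D k (\<phi> x))" if "i \<in> Basis" for i
    using that D(2) E(2) Suc.IH Suc.prems(3)
    by (intro Ck_sum Ck_bounded_bilinear[OF bounded_bilinear_scaleR]
        Ck_bounded_linear_comp[OF bounded_linear_inner_left]) auto
  ultimately show ?case
    by (auto intro!: exI[of _ "\<lambda>i x. \<Sum>k\<in>Basis. (E i x \<bullet> k) *\<^sub>R D k (\<phi> x)"])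
qed

text \<open>A complex derivative \<open>f'\<close> has the real partials \<open>f' x * i\<close> for
  \<open>i\<close> in {1, \<i>}. This is the induction step for \<open>exp\<close> and
  \<open>inverse\<close>, whose derivatives are built from the functions themselves.\<close>

lemma Ck_field_derivative:
  fixes f :: "complex \<Rightarrow> complex"
  assumes "\<And>x. x \<in> S \<Longrightarrow> (f has_field_derivative f' x) (at x within S)" "Ck n S f'"
  shows "Ck (Suc n) S f"
proof -
  have "(f has_derivative (\<lambda>h. \<Sum>i\<in>Basis. (h \<bullet> i) *\<^sub>R (f' x * i))) (at x within S)" if "x \<in> S" for x
  proof -
    have "(\<lambda>h. \<Sum>i\<in>Basis. (h \<bullet> i) *\<^sub>R (f' x * i)) = (*) (f' x)"
      by (auto simp: Basis_complex_def complex_eq_iff algebra_simps)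
    then show ?thesis using assms(1)[OF that] by (simp add: has_field_derivative_def)
  qed
  then show ?thesis using assms(2)
    by (auto intro!: exI[of _ "\<lambda>i x. f' x * i"] Ck_mult)
qed

lemma Ck_exp: "Ck n S (exp :: complex \<Rightarrow> complex)"
proof (induction n)
  case (Suc n)
  show ?case by (rule Ck_field_derivative[OF _ Suc]) (auto intro: DERIV_exp has_field_derivative_at_within)
qed (simp add: continuous_on_exp)

lemma Ck_inverse:
  fixes S :: "complex set"
  assumes "0 \<notin> S"
  shows "Ck n S inverse"
proof (induction n)
  case 0
  show ?case using assms by (auto intro!: continuous_intros)
next
  case (Suc n)
  show ?case
  proof (rule Ck_field_derivative)
    show "(inverse has_field_derivative - (inverse x * inverse x)) (at x within S)" if "x \<in> S" for x
      using that assms DERIV_inverse[of x S] by (auto simp: power2_eq_square)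
  qed (intro Ck_uminus Ck_mult Suc)
qed

lemma Ck_Ln:
  assumes "S \<inter> \<real>\<^sub>\<le>\<^sub>0 = {}"
  shows "Ck n S Ln"
proof (cases n)
  case 0
  then show ?thesis using assms by (auto intro!: continuous_on_Ln)
next
  case (Suc m)
  have "Ck (Suc m) S Ln"
  proof (rule Ck_field_derivative)
    show "(Ln has_field_derivative inverse x) (at x within S)" if "x \<in> S" for x
      using that assms by (auto intro!: has_field_derivative_at_within[OF has_field_derivative_Ln])
  qed (use assms in \<open>auto intro!: Ck_inverse\<close>)
  then show ?thesis using Suc by simp
qed

section \<open>Passing between finite order and \<open>smooth_on\<close>\<close>

lemma smooth_on_imp_Ck: "smooth_on S f \<Longrightarrow> Ck n S f"
proof (induction n arbitrary: f)
  case 0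
  then show ?case by (auto elim!: smooth_on.cases intro: has_derivative_continuous_on)
next
  case (Suc n)
  from Suc.prems show ?case
    by (cases rule: smooth_on.cases) (auto intro!: Suc.IH)
qed

text \<open>Each order comes with its own partials \<open>D n\<close>, which on a thin set could
  differ. If every point is a limit of points of \<open>S\<close> along each coordinate direction,
  partials are unique, so the single family \<open>D 0\<close> has every order and serves for the
  coinduction.\<close>

lemma Ck_imp_smooth_on:
  assumes S: "\<And>x i e. x \<in> S \<Longrightarrow> i \<in> Basis \<Longrightarrow> 0 < e \<Longrightarrow> \<exists>d. 0 < \<bar>d\<bar> \<and> \<bar>d\<bar> < e \<and> x + d *\<^sub>R i \<in> S"
    and "\<And>n. Ck n S f"
  shows "smooth_on S f"
proof -
  have "\<forall>n. Ck n S f" using assms by simp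
  then show ?thesis
  proof (coinduction arbitrary: f)
    case (smooth_on f)
    then have "\<forall>n. Ck (Suc n) S f" by blast
    then have "\<forall>n. \<exists>D. (\<forall>x\<in>S. (f has_derivative (\<lambda>h. \<Sum>i\<in>Basis. (h \<bullet> i) *\<^sub>R D i x)) (at x within S))
        \<and> (\<forall>i\<in>Basis. Ck n S (D i))" by simp
    from choice[OF this] obtain D where D:
      "\<And>n x. x\<in>S \<Longrightarrow> (f has_derivative (\<lambda>h. \<Sum>i\<in>Basis. (h \<bullet> i) *\<^sub>R D n i x)) (at x within S)"
      "\<And>n i. i\<in>Basis \<Longrightarrow> Ck n S (D n i)" by blast
    have eq: "D n i x = D 0 i x" if "x \<in> S" "i \<in> Basis" for n i x
    proof -
      have "(\<lambda>h. \<Sum>i\<in>Basis. (h \<bullet> i) *\<^sub>R D n i x) = (\<lambda>h. \<Sum>i\<in>Basis. (h \<bullet> i) *\<^sub>R D 0 i x)"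
        by (rule frechet_derivative_unique_within[OF D(1) D(1)]) (use S that in auto)
      from fun_cong[OF this, of i] show ?thesis
        using that(2) by (simp add: inner_Basis if_distrib[of "\<lambda>c. c *\<^sub>R _"] cong: if_cong)
    qed
    have "Ck n S (D 0 i)" if "i \<in> Basis" for n i
      by (rule Ck_cong[OF D(2)[OF that, of n] eq[OF _ that]])
    then show ?case using D(1)[of _ 0] by auto
  qed
qed

lemma smooth_on_UNIV_iff_Ck:
  fixes f :: "'a::euclidean_space \<Rightarrow> 'b::real_normed_vector"
  shows "smooth_on UNIV f \<longleftrightarrow> (\<forall>n. Ck n UNIV f)"
proof
  assume "\<forall>n. Ck n UNIV f"
  moreover have "\<exists>d. 0 < \<bar>d\<bar> \<and> \<bar>d\<bar> < e \<and> x + d *\<^sub>R i \<in> UNIV" if "0 < e" for e and x i :: 'a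
    using that by (intro exI[of _ "e/2"]) simp
  ultimately show "smooth_on UNIV f" by (intro Ck_imp_smooth_on) auto
qed (simp add: smooth_on_imp_Ck)

lemma smooth_on_subset:
  assumes "smooth_on S f" "T \<subseteq> S"
  shows "smooth_on T f"
  using assms(1)
proof (coinduction arbitrary: f)
  case (smooth_on f)
  then obtain D where D:
    "\<forall>x\<in>S. (f has_derivative (\<lambda>h. \<Sum>i\<in>Basis. (h \<bullet> i) *\<^sub>R D i x)) (at x within S)"
    "\<forall>i\<in>Basis. smooth_on S (D i)" by (auto elim: smooth_on.cases)
  have "(f has_derivative (\<lambda>h. \<Sum>i\<in>Basis. (h \<bullet> i) *\<^sub>R D i x)) (at x within T)" if "x \<in> T" for x
    using D(1) that assms(2) has_derivative_subset by blast
  then show ?case using D(2) by (intro exI[of _ T] exI[of _ f] exI[of _ D]) simp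
qed

text \<open>On open sets partials are unique, so the local ones all agree with the global
  \<open>frechet_derivative\<close>, and the induction continues with that.\<close>

lemma Ck_UNIV_locally:
  assumes "\<And>x. \<exists>U. open U \<and> x \<in> U \<and> Ck n U f"
  shows "Ck n UNIV f"
  using assms
proof (induction n arbitrary: f)
  case 0
  then show ?case
    by (metis Ck.simps(1) continuous_at_imp_continuous_on continuous_on_eq_continuous_at)
next
  case (Suc n)
  define D where "D = (\<lambda>i x. frechet_derivative f (at x) i)"
  have loc: "(\<forall>x\<in>U. (f has_derivative (\<lambda>h. \<Sum>i\<in>Basis. (h \<bullet> i) *\<^sub>R D i x)) (at x)) \<and> (\<forall>i\<in>Basis. Ck n U (D i))"
    if U: "open U" "Ck (Suc n) U f" for U
  proof -
    from U(2) obtain E where E: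
      "\<forall>x\<in>U. (f has_derivative (\<lambda>h. \<Sum>i\<in>Basis. (h \<bullet> i) *\<^sub>R E i x)) (at x within U)"
      "\<forall>i\<in>Basis. Ck n U (E i)" by auto
    have E': "(f has_derivative (\<lambda>h. \<Sum>i\<in>Basis. (h \<bullet> i) *\<^sub>R E i x)) (at x)" if "x \<in> U" for x
      using E(1)[rule_format, OF that] unfolding at_within_open[OF that U(1)] .
    have DE: "D i x = E i x" if "x \<in> U" "i \<in> Basis" for x i
      using fun_cong[OF frechet_derivative_at[OF E'[OF that(1)]], of i] that(2) unfolding D_def
      by (simp add: inner_Basis if_distrib[of "\<lambda>c. c *\<^sub>R _"] cong: if_cong)
    have "Ck n U (D i)" if "i \<in> Basis" for i
      using Ck_cong[OF E(2)[rule_format, OF that]] DE that by metis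
    moreover have "(f has_derivative (\<lambda>h. \<Sum>i\<in>Basis. (h \<bullet> i) *\<^sub>R D i x)) (at x)" if "x \<in> U" for x
      using E'[OF that] DE[OF that] by simp
    ultimately show ?thesis by blast
  qed
  have "Ck n UNIV (D i)" if "i \<in> Basis" for i
  proof (rule Suc.IH)
    fix x
    obtain U where "open U" "x \<in> U" "Ck (Suc n) U f" using Suc.prems by blast
    then show "\<exists>U. open U \<and> x \<in> U \<and> Ck n U (D i)" using loc that by blast
  qed
  moreover have "(f has_derivative (\<lambda>h. \<Sum>i\<in>Basis. (h \<bullet> i) *\<^sub>R D i x)) (at x)" for x
    using Suc.prems loc by blast
  ultimately show ?case by auto
qed

subsection \<open>Integrals depending on a parameter\<close>

text \<open>A closed ball around \<open>p0\<close> times \<open>K\<close> is compact, so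
  \<open>f\<close> is uniformly continuous there; the points \<open>(p, v)\<close> and
  \<open>(p0, v)\<close> are as close as \<open>p\<close> and \<open>p0\<close>.\<close>

lemma continuous_on_Times_compact_uniform:
  fixes f :: "'a::euclidean_space \<times> real \<Rightarrow> 'b::metric_space"
  assumes cont: "continuous_on (S \<times> K) f" and S: "open S" and K: "compact K" and "p0 \<in> S" "e > 0"
  shows "\<exists>d>0. ball p0 d \<subseteq> S \<and> (\<forall>p\<in>ball p0 d. \<forall>v\<in>K. dist (f (p, v)) (f (p0, v)) < e)"
proof -
  obtain r where r: "r > 0" "cball p0 r \<subseteq> S" using S \<open>p0 \<in> S\<close> open_contains_cball by blast
  have "uniformly_continuous_on (cball p0 r \<times> K) f"
    by (rule compact_uniformly_continuous)
      (use cont r K in \<open>auto intro: continuous_on_subset compact_Times\<close>)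
  then obtain d where d: "d > 0"
    "\<And>x y. x \<in> cball p0 r \<times> K \<Longrightarrow> y \<in> cball p0 r \<times> K \<Longrightarrow> dist y x < d \<Longrightarrow> dist (f y) (f x) < e"
    unfolding uniformly_continuous_on_def using \<open>e > 0\<close> by metis
  have "dist (f (p, v)) (f (p0, v)) < e" if "p \<in> ball p0 (min r d)" "v \<in> K" for p v
    using that r by (intro d(2)) (auto simp: dist_Pair_Pair dist_commute)
  then show ?thesis using r d(1) by (intro exI[of _ "min r d"]) auto
qed

text \<open>The map \<open>v\<close> sends the whole line into a compact set on which
  \<open>f\<close> is controlled up to the ends. All bounds on \<open>f\<close> and its partials are
  therefore uniform in \<open>s\<close>, and integrability of \<open>k\<close> alone justifies
  differentiation under the integral.\<close>

lemma Ck_parameter_integral: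
  fixes f :: "'a::euclidean_space \<times> real \<Rightarrow> complex" and k v :: "real \<Rightarrow> real"
  assumes k: "integrable lborel k" and v: "continuous_on UNIV v" "\<And>s. v s \<in> K"
    and S: "open S" and K: "compact K"
  shows "Ck n (S \<times> K) f \<Longrightarrow>
    (\<forall>p\<in>S. integrable lborel (\<lambda>s. k s *\<^sub>R f (p, v s))) \<and> Ck n S (\<lambda>p. \<integral>s. k s *\<^sub>R f (p, v s) \<partial>lborel)"
proof (induction n arbitrary: f)
  have int: "integrable lborel (\<lambda>s. k s *\<^sub>R f (p, v s))"
    if f: "continuous_on (S \<times> K) f" and p: "p \<in> S" for p and f :: "'a \<times> real \<Rightarrow> complex"
  proof -
    have c: "continuous_on K (\<lambda>y. f (p, y))"
      by (rule continuous_on_compose2[OF f]) (use p in \<open>auto intro!: continuous_intros\<close>)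
    then have "bounded ((\<lambda>y. f (p, y)) ` K)"
      using K compact_continuous_image compact_imp_bounded by blast
    then obtain B where B: "\<And>y. y \<in> K \<Longrightarrow> norm (f (p, y)) \<le> B" unfolding bounded_iff by auto
    have "continuous_on UNIV (\<lambda>s. f (p, v s))"
      by (rule continuous_on_compose2[OF c v(1)]) (use v in auto)
    then have m: "(\<lambda>s. f (p, v s)) \<in> borel_measurable borel"
      by (rule borel_measurable_continuous_onI)
    show ?thesis
    proof (rule Bochner_Integration.integrable_bound)
      show "integrable lborel (\<lambda>s. \<bar>B\<bar> * k s)" using k by simp
      show "(\<lambda>s. k s *\<^sub>R f (p, v s)) \<in> borel_measurable lborel"
        using m k by (intro borel_measurable_scaleR) auto
      show "AE s in lborel. norm (k s *\<^sub>R f (p, v s)) \<le> norm (\<bar>B\<bar> * k s)"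
      proof (rule AE_I2)
        fix s
        have "norm (f (p, v s)) \<le> \<bar>B\<bar>" using B[OF v(2), of s] by linarith
        from mult_left_mono[OF this, of "\<bar>k s\<bar>"]
        show "norm (k s *\<^sub>R f (p, v s)) \<le> norm (\<bar>B\<bar> * k s)"
          by (simp add: abs_mult mult.commute)
      qed
    qed
  qed
  have diff_le: "norm (\<integral>s. k s *\<^sub>R h (v s) \<partial>lborel) \<le> e * (\<integral>s. \<bar>k s\<bar> \<partial>lborel)"
    if "integrable lborel (\<lambda>s. k s *\<^sub>R h (v s))" "\<And>y. y \<in> K \<Longrightarrow> norm (h y) \<le> e" for h :: "real \<Rightarrow> complex" and e
  proof -
    have "norm (\<integral>s. k s *\<^sub>R h (v s) \<partial>lborel) \<le> (\<integral>s. norm (k s *\<^sub>R h (v s)) \<partial>lborel)"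
      by (rule integral_norm_bound)
    also have "\<dots> \<le> (\<integral>s. e * \<bar>k s\<bar> \<partial>lborel)"
    proof (rule integral_mono)
      show "integrable lborel (\<lambda>s. norm (k s *\<^sub>R h (v s)))" using that(1) by (rule integrable_norm)
      show "integrable lborel (\<lambda>s. e * \<bar>k s\<bar>)" using k by simp
      show "norm (k s *\<^sub>R h (v s)) \<le> e * \<bar>k s\<bar>" for s
        using mult_left_mono[OF that(2)[OF v(2)], of "\<bar>k s\<bar>" s] by (simp add: mult.commute)
    qed
    finally show ?thesis by simp
  qed
  have cont: "continuous_on S (\<lambda>p. \<integral>s. k s *\<^sub>R f (p, v s) \<partial>lborel)"
    if f: "continuous_on (S \<times> K) f" for f :: "'a \<times> real \<Rightarrow> complex"
  proof (rule continuous_at_imp_continuous_on, rule ballI)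
    fix p0 assume p0: "p0 \<in> S"
    show "isCont (\<lambda>p. \<integral>s. k s *\<^sub>R f (p, v s) \<partial>lborel) p0"
      unfolding continuous_at_eps_delta
    proof (intro allI impI)
      fix e :: real assume "e > 0"
      define M where "M = (\<integral>s. \<bar>k s\<bar> \<partial>lborel) + 1"
      have M: "M > 0" unfolding M_def by (simp add: add_nonneg_pos)
      obtain d where d: "d > 0" "ball p0 d \<subseteq> S" "\<And>p y. p\<in>ball p0 d \<Longrightarrow> y \<in> K \<Longrightarrow> dist (f (p, y)) (f (p0, y)) < e / M"
        using continuous_on_Times_compact_uniform[OF f S K p0, of "e / M"] \<open>e > 0\<close> M by auto
      have "dist (\<integral>s. k s *\<^sub>R f (p, v s) \<partial>lborel) (\<integral>s. k s *\<^sub>R f (p0, v s) \<partial>lborel) < e" if "dist p p0 < d" for p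
      proof -
        have p: "p \<in> ball p0 d" using that by (simp add: dist_commute)
        note i = int[OF f, of p] int[OF f p0]
        have pS: "p \<in> S" using p d by auto
        have "norm (\<integral>s. k s *\<^sub>R (f (p, v s) - f (p0, v s)) \<partial>lborel) \<le> e / M * (\<integral>s. \<bar>k s\<bar> \<partial>lborel)"
          using d(3)[OF p] i pS by (intro diff_le) (auto simp: scaleR_diff_right dist_norm less_imp_le)
        also have "\<dots> < e / M * M" using \<open>e > 0\<close> M by (intro mult_strict_left_mono) (auto simp: M_def)
        finally show ?thesis using M i pS by (simp add: dist_norm scaleR_diff_right)
      qed
      then show "\<exists>d>0. \<forall>x'. dist x' p0 < d \<longrightarrow>
        dist (\<integral>s. k s *\<^sub>R f (x', v s) \<partial>lborel) (\<integral>s. k s *\<^sub>R f (p0, v s) \<partial>lborel) < e"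
        using d(1) by blast
    qed
  qed
  {
    case 0
    then show ?case using int cont by simp
  next
    case (Suc n)
    from Suc.prems obtain D where D:
      "\<And>x. x\<in>S\<times>K \<Longrightarrow> (f has_derivative (\<lambda>h. \<Sum>i\<in>Basis. (h \<bullet> i) *\<^sub>R D i x)) (at x within S\<times>K)"
      "\<And>i. i\<in>Basis \<Longrightarrow> Ck n (S\<times>K) (D i)" unfolding Ck.simps(2) by blast
    have f: "continuous_on (S \<times> K) f" using Suc.prems by (rule Ck_imp_continuous_on)
    \<comment> \<open>The directions \<open>(i, 0)\<close> of the product are those of the parameter
      \<open>p\<close>.\<close>
    define E where "E = (\<lambda>i p. \<integral>s. k s *\<^sub>R D (i, 0) (p, v s) \<partial>lborel)"
    have B: "(i, 0) \<in> (Basis :: ('a \<times> real) set)" if "i \<in> Basis" for i using that by (simp add: Basis_prod_def)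
    have E: "Ck n S (E i)" if "i \<in> Basis" for i
      using Suc.IH[OF D(2)[OF B[OF that]]] by (simp add: E_def)
    have Dc: "continuous_on (S \<times> K) (D (i, 0))" if "i \<in> Basis" for i
      using D(2)[OF B[OF that]] by (rule Ck_imp_continuous_on)
    have fp: "((\<lambda>p. f (p, y)) has_derivative (\<lambda>h. \<Sum>i\<in>Basis. (h \<bullet> i) *\<^sub>R D (i, 0) (p, y))) (at p within T)"
      if "p \<in> T" "T \<subseteq> S" "y \<in> K" for p y T
    proof -
      have "((\<lambda>p. (p, y)) has_derivative (\<lambda>h. (h, 0))) (at p within T)"
        by (auto intro!: derivative_eq_intros)
      moreover have "(f has_derivative (\<lambda>h. \<Sum>i\<in>Basis. (h \<bullet> i) *\<^sub>R D i (p, y))) (at (p, y) within (\<lambda>p. (p, y)) ` T)"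
        using that by (intro has_derivative_subset[OF D(1)]) auto
      ultimately have "((\<lambda>p. f (p, y)) has_derivative (\<lambda>h. \<Sum>i\<in>Basis. ((h, 0) \<bullet> i) *\<^sub>R D i (p, y))) (at p within T)"
        by (rule has_derivative_in_compose)
      moreover have "(\<Sum>i\<in>Basis. ((h, 0::real) \<bullet> i) *\<^sub>R D i (p, y)) = (\<Sum>i\<in>Basis. (h \<bullet> i) *\<^sub>R D (i, 0) (p, y))" for h
        unfolding Basis_prod_def
        by (subst sum.union_disjoint) (auto simp: sum.reindex inj_on_def)
      ultimately show ?thesis by simp
    qed
    have "((\<lambda>p. \<integral>s. k s *\<^sub>R f (p, v s) \<partial>lborel) has_derivative (\<lambda>h. \<Sum>i\<in>Basis. (h \<bullet> i) *\<^sub>R E i p0)) (at p0 within S)"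
      if p0: "p0 \<in> S" for p0
    proof -
      let ?F = "\<lambda>p. \<integral>s. k s *\<^sub>R f (p, v s) \<partial>lborel"
      let ?L = "\<lambda>h. \<Sum>i\<in>Basis. (h \<bullet> i) *\<^sub>R E i p0"
      have "(?F has_derivative ?L) (at p0)"
        unfolding has_derivative_at_alt
      proof (intro conjI allI impI)
        show "bounded_linear ?L"
          by (auto intro!: bounded_linear_intros)
        fix e :: real assume "e > 0"
        define M where "M = (\<integral>s. \<bar>k s\<bar> \<partial>lborel) + 1"
        have M: "M > 0" unfolding M_def by (simp add: add_nonneg_pos)
        \<comment> \<open>Each of the \<open>DIM('a)\<close> partials may vary by \<open>e'\<close>,
          which keeps the derivative within \<open>e / M\<close> in operator norm; integrating
          against \<open>\<bar>k s\<bar>\<close> then costs at most a factor \<open>M\<close>. The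
          summand 1 in \<open>M\<close> keeps it positive when \<open>k\<close> vanishes.\<close>
        define e' where "e' = e / (M * real DIM('a))"
        have e': "e' > 0" using \<open>e > 0\<close> M by (simp add: e'_def)
        have "\<forall>i\<in>Basis. \<exists>d>0. ball p0 d \<subseteq> S \<and> (\<forall>p\<in>ball p0 d. \<forall>y\<in>K. dist (D (i, 0) (p, y)) (D (i, 0) (p0, y)) < e')"
          using continuous_on_Times_compact_uniform[OF Dc S K p0 e'] by blast
        then obtain d where d: "\<And>i::'a. i\<in>Basis \<Longrightarrow> d i > 0 \<and> ball p0 (d i) \<subseteq> S \<and>
            (\<forall>p\<in>ball p0 (d i). \<forall>y\<in>K. dist (D (i, 0) (p, y)) (D (i, 0) (p0, y)) < e')" by metis
        define r where "r = Min (d ` Basis)"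
        have r: "r > 0" unfolding r_def using d by simp
        have rd: "r \<le> d i" if "i \<in> Basis" for i using that unfolding r_def by simp
        have rS: "ball p0 r \<subseteq> S" using d rd nonempty_Basis
          by (metis ex_in_conv subset_ball subset_trans)
        have "norm (?F p - ?F p0 - ?L (p - p0)) \<le> e * norm (p - p0)" if "norm (p - p0) < r" for p
        proof -
          have pr: "p \<in> ball p0 r" using that by (simp add: dist_norm norm_minus_commute)
          have pS: "p \<in> S" using pr rS by auto
          \<comment> \<open>The linearisation error at fixed \<open>y\<close>. The mean value
            inequality on the ball bounds it uniformly in \<open>y\<close>, and its integral is the
            linearisation error of the integral.\<close>
          define h where "h = (\<lambda>y. f (p, y) - f (p0, y) - (\<Sum>i\<in>Basis. ((p - p0) \<bullet> i) *\<^sub>R D (i, 0) (p0, y)))"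
          have hb: "norm (h y) \<le> norm (p - p0) * (e / M)" if y: "y \<in> K" for y
            unfolding h_def
          proof (rule differentiable_bound_linearization[where S = "ball p0 r" and
              f' = "\<lambda>q h. \<Sum>i\<in>Basis. (h \<bullet> i) *\<^sub>R D (i, 0) (q, y)"])
            show "p0 + t *\<^sub>R (p - p0) \<in> ball p0 r" if "t \<in> {0..1}" for t
            proof -
              have "\<bar>t\<bar> * norm (p - p0) \<le> 1 * norm (p - p0)" using that by (intro mult_right_mono) auto
              then show ?thesis using \<open>norm (p - p0) < r\<close> by (simp add: dist_norm)
            qed
            show "((\<lambda>p. f (p, y)) has_derivative (\<lambda>h. \<Sum>i\<in>Basis. (h \<bullet> i) *\<^sub>R D (i, 0) (q, y))) (at q within ball p0 r)"
              if "q \<in> ball p0 r" for q using fp that rS y by blast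
            show "p0 \<in> ball p0 r" using r by simp
            show "onorm ((\<lambda>h. \<Sum>i\<in>Basis. (h \<bullet> i) *\<^sub>R D (i, 0) (q, y)) - (\<lambda>h. \<Sum>i\<in>Basis. (h \<bullet> i) *\<^sub>R D (i, 0) (p0, y))) \<le> e / M"
              if q: "q \<in> ball p0 r" for q
            proof (rule onorm_bound)
              show "0 \<le> e / M" using \<open>e > 0\<close> M by simp
              fix x :: 'a
              have "norm ((\<Sum>i\<in>Basis. (x \<bullet> i) *\<^sub>R D (i, 0) (q, y)) - (\<Sum>i\<in>Basis. (x \<bullet> i) *\<^sub>R D (i, 0) (p0, y)))
                = norm (\<Sum>i\<in>Basis. (x \<bullet> i) *\<^sub>R (D (i, 0) (q, y) - D (i, 0) (p0, y)))"
                by (simp add: sum_subtractf scaleR_diff_right)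
              also have "\<dots> \<le> (\<Sum>i\<in>(Basis::'a set). norm x * e')"
              proof (rule sum_norm_le)
                fix i :: 'a assume i: "i \<in> Basis"
                have "q \<in> ball p0 (d i)" using q rd[OF i] by auto
                then have "norm (D (i, 0) (q, y) - D (i, 0) (p0, y)) < e'" using d[OF i] y by (auto simp: dist_norm)
                then show "norm ((x \<bullet> i) *\<^sub>R (D (i, 0) (q, y) - D (i, 0) (p0, y))) \<le> norm x * e'"
                  using Basis_le_norm[OF i, of x] by (auto intro!: mult_mono)
              qed
              also have "\<dots> = e / M * norm x" by (simp add: e'_def)
              finally show "norm (((\<lambda>h. \<Sum>i\<in>Basis. (h \<bullet> i) *\<^sub>R D (i, 0) (q, y)) - (\<lambda>h. \<Sum>i\<in>Basis. (h \<bullet> i) *\<^sub>R D (i, 0) (p0, y))) x) \<le> e / M * norm x"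
                by simp
            qed
          qed
          note i = int[OF f pS] int[OF f p0] int[OF Dc p0]
          have hs: "k s *\<^sub>R h (v s) = k s *\<^sub>R f (p, v s) - k s *\<^sub>R f (p0, v s)
              - (\<Sum>i\<in>Basis. ((p - p0) \<bullet> i) *\<^sub>R (k s *\<^sub>R D (i, 0) (p0, v s)))" for s
            by (simp add: h_def scaleR_diff_right scaleR_sum_right mult.commute)
          have i': "integrable lborel (\<lambda>s. \<Sum>i\<in>Basis. ((p - p0) \<bullet> i) *\<^sub>R (k s *\<^sub>R D (i, 0) (p0, v s)))"
            by (intro Bochner_Integration.integrable_sum integrable_scaleR_right i)
          have ih: "integrable lborel (\<lambda>s. k s *\<^sub>R h (v s))"
            unfolding hs by (intro Bochner_Integration.integrable_diff i i')
          have "(\<integral>s. k s *\<^sub>R h (v s) \<partial>lborel) = ?F p - ?F p0 - ?L (p - p0)"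
          proof -
            have "(\<integral>s. (\<Sum>i\<in>Basis. ((p - p0) \<bullet> i) *\<^sub>R (k s *\<^sub>R D (i, 0) (p0, v s))) \<partial>lborel) = ?L (p - p0)"
              unfolding E_def
              by (subst Bochner_Integration.integral_sum)
                (intro integrable_scaleR_right i, simp_all del: scaleR_scaleR)
            then show ?thesis
              unfolding hs using i i' by (simp add: Bochner_Integration.integral_diff del: scaleR_scaleR)
          qed
          moreover have "norm (\<integral>s. k s *\<^sub>R h (v s) \<partial>lborel) \<le> norm (p - p0) * (e / M) * (\<integral>s. \<bar>k s\<bar> \<partial>lborel)"
            by (rule diff_le[OF ih hb])
          moreover have "\<dots> \<le> norm (p - p0) * (e / M) * M"
            using \<open>e > 0\<close> M by (intro mult_left_mono) (auto simp: M_def)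
          ultimately show ?thesis using M by (simp add: mult.commute)
        qed
        then show "\<exists>d>0. \<forall>p. norm (p - p0) < d \<longrightarrow> norm (?F p - ?F p0 - ?L (p - p0)) \<le> e * norm (p - p0)"
          using r by blast
      qed
      then show ?thesis by (rule has_derivative_at_withinI)
    qed
    then show ?case using E int[OF f] by (auto intro!: exI[of _ E])
  }
qed

subsection \<open>Smooth reflection across the imaginary axis\<close>

text \<open>\<open>exp\<close> maps this half-plane onto the closed unit disk without its centre,
  and the imaginary axis onto the circle.\<close>

definition left_halfplane :: "complex set" where "left_halfplane = {z. Re z \<le> 0}"

definition has_partials :: "(complex \<Rightarrow> complex) \<Rightarrow> (complex \<Rightarrow> complex) \<Rightarrow> (complex \<Rightarrow> complex) \<Rightarrow> bool" where
  "has_partials F Fs Fw \<longleftrightarrow> (\<forall>z\<in>left_halfplane. (F has_derivative (\<lambda>h. Re h *\<^sub>R Fs z + Im h *\<^sub>R Fw z)) (at z within left_halfplane))"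

lemma smooth_on_obtain_partials:
  assumes "smooth_on left_halfplane F"
  obtains Fs Fw where "smooth_on left_halfplane Fs" "smooth_on left_halfplane Fw" "has_partials F Fs Fw"
proof -
  from assms obtain D where D:
    "\<forall>x\<in>left_halfplane. (F has_derivative (\<lambda>h. \<Sum>i\<in>Basis. (h \<bullet> i) *\<^sub>R D i x)) (at x within left_halfplane)"
    "\<forall>i\<in>Basis. smooth_on left_halfplane (D i)" by (auto elim: smooth_on.cases)
  show ?thesis
    by (rule that[of "D 1" "D \<i>"]) (use D in \<open>auto simp: has_partials_def Basis_complex_def inner_complex_def\<close>)
qed

lemma has_partials_has_vector_derivative_Re:
  assumes "has_partials F Fs Fw" "s \<le> 0"
  shows "((\<lambda>s. F (Complex s w)) has_vector_derivative Fs (Complex s w)) (at s within {..0})"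
proof -
  have 1: "((\<lambda>s. Complex s w) has_derivative (\<lambda>h. Complex h 0)) (at s within {..0})"
    unfolding Complex_eq by (auto intro!: derivative_eq_intros)
  have "(F has_derivative (\<lambda>h. Re h *\<^sub>R Fs (Complex s w) + Im h *\<^sub>R Fw (Complex s w)))
      (at (Complex s w) within (\<lambda>s. Complex s w) ` {..0})"
    using assms by - (rule has_derivative_subset[of F _ _ left_halfplane]; auto simp: has_partials_def left_halfplane_def)
  from has_derivative_in_compose[OF 1 this] show ?thesis
    by (simp add: has_vector_derivative_def)
qed

lemma has_partials_has_vector_derivative_Im:
  assumes "has_partials F Fs Fw" "s \<le> 0"
  shows "((\<lambda>w. F (Complex s w)) has_vector_derivative Fw (Complex s w)) (at w within T)"
proof -
  have 1: "((\<lambda>w. Complex s w) has_derivative (\<lambda>h. Complex 0 h)) (at w within T)"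
    unfolding Complex_eq by (auto intro!: derivative_eq_intros)
  have "(F has_derivative (\<lambda>h. Re h *\<^sub>R Fs (Complex s w) + Im h *\<^sub>R Fw (Complex s w)))
      (at (Complex s w) within (\<lambda>w. Complex s w) ` T)"
    using assms by - (rule has_derivative_subset[of F _ _ left_halfplane]; auto simp: has_partials_def left_halfplane_def)
  from has_derivative_in_compose[OF 1 this] show ?thesis
    by (simp add: has_vector_derivative_def)
qed

lemma has_vector_derivative_unique_atMost:
  assumes "(f has_vector_derivative a) (at s within {..0::real})" "(f has_vector_derivative b) (at s within {..0})" "s \<le> 0"
  shows "a = b"
proof -
  have "((f has_vector_derivative c) (at s within {s-1..s}))" if "(f has_vector_derivative c) (at s within {..0})" for c
    using that assms(3) by (auto intro: has_vector_derivative_within_subset)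
  then show ?thesis
    using vector_derivative_unique_within_closed_interval[of "s-1" s s f a b] assms by auto
qed

text \<open>Both mixed partials have the same integral over \<open>{s - 1..u}\<close> in the first
  variable: differentiating the integral of \<open>Fs\<close> in \<open>w\<close> gives that of
  \<open>Fsw\<close>, while the fundamental theorem turns it into a difference of values of
  \<open>Fw\<close>, which is the integral of \<open>Fws\<close>. Differentiation in the upper limit
  \<open>u\<close> from the left works on the boundary of the half-plane too.\<close>

lemma mixed_partials_eq:
  assumes F: "has_partials F Fs Fw" and Fs: "has_partials Fs Fss Fsw" and Fw: "has_partials Fw Fws Fww"
    and cont: "continuous_on left_halfplane Fs" "continuous_on left_halfplane Fsw" "continuous_on left_halfplane Fws" and s: "s \<le> 0"
  shows "Fsw (Complex s w) = Fws (Complex s w)"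
proof -
  let ?a = "s - 1"
  have cC: "continuous_on A (\<lambda>t. Complex t w)" for A w unfolding Complex_eq by (intro continuous_intros)
  have c: "continuous_on {?a..u} (\<lambda>t. f (Complex t w))" if "continuous_on left_halfplane f" "u \<le> 0"
    for f :: "complex \<Rightarrow> complex" and u w
    by (rule continuous_on_compose2[OF that(1) cC]) (use that in \<open>auto simp: left_halfplane_def\<close>)
  have eq: "integral {?a..u} (\<lambda>t. Fsw (Complex t w)) = integral {?a..u} (\<lambda>t. Fws (Complex t w))"
    if u: "u \<in> {?a..s}" for u
  proof -
    have "((\<lambda>w. integral (cbox ?a u) (\<lambda>t. Fs (Complex t w))) has_vector_derivative
        integral (cbox ?a u) (\<lambda>t. Fsw (Complex t w))) (at w within UNIV)"
    proof (rule leibniz_rule_vector_derivative)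
      show "((\<lambda>w. Fs (Complex t w)) has_vector_derivative Fsw (Complex t w)) (at w within UNIV)"
        if "t \<in> cbox ?a u" for w t
        using has_partials_has_vector_derivative_Im[OF Fs] that u s by auto
      show "(\<lambda>t. Fs (Complex t w)) integrable_on cbox ?a u" for w
        using c[OF cont(1)] u s by (auto intro!: integrable_continuous_real)
      have "continuous_on (UNIV \<times> cbox ?a u) (\<lambda>x. Complex (snd x) (fst x))"
        unfolding Complex_eq by (intro continuous_intros)
      then have "continuous_on (UNIV \<times> cbox ?a u) (\<lambda>x. Fsw (Complex (snd x) (fst x)))"
        by (rule continuous_on_compose2[OF cont(2)]) (use u s in \<open>auto simp: left_halfplane_def\<close>)
      then show "continuous_on (UNIV \<times> cbox ?a u) (\<lambda>(w, t). Fsw (Complex t w))"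
        by (simp add: case_prod_unfold)
    qed auto
    moreover have "integral (cbox ?a u) (\<lambda>t. Fs (Complex t w)) = F (Complex u w) - F (Complex ?a w)" for w
    proof -
      have "((\<lambda>t. Fs (Complex t w)) has_integral (F (Complex u w) - F (Complex ?a w))) {?a..u}"
        using u s by (intro fundamental_theorem_of_calculus)
          (auto intro!: has_vector_derivative_within_subset[OF has_partials_has_vector_derivative_Re[OF F]])
      then show ?thesis by (simp add: integral_unique)
    qed
    moreover have "((\<lambda>t. Fws (Complex t w)) has_integral (Fw (Complex u w) - Fw (Complex ?a w))) {?a..u}"
        using u s by (intro fundamental_theorem_of_calculus)
          (auto intro!: has_vector_derivative_within_subset[OF has_partials_has_vector_derivative_Re[OF Fw]])
    moreover have "((\<lambda>w. F (Complex u w) - F (Complex ?a w)) has_vector_derivative Fw (Complex u w) - Fw (Complex ?a w)) (at w within UNIV)"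
      using u s by (intro has_vector_derivative_diff has_partials_has_vector_derivative_Im[OF F]) auto
    ultimately show ?thesis
      using vector_derivative_unique_at by (auto simp: integral_unique)
  qed
  have 1: "((\<lambda>u. integral {?a..u} (\<lambda>t. f (Complex t w))) has_vector_derivative f (Complex s w)) (at s within {?a..s})"
    if "continuous_on left_halfplane f" for f :: "complex \<Rightarrow> complex"
    by (rule integral_has_vector_derivative[OF c[OF that s]]) auto
  have 2: "((\<lambda>u. integral {?a..u} (\<lambda>t. Fsw (Complex t w))) has_vector_derivative Fws (Complex s w)) (at s within {?a..s})"
    by (rule has_vector_derivative_transform[OF _ _ 1[OF cont(3)]]) (use eq in auto)
  show ?thesis
    using vector_derivative_unique_within_closed_interval[of ?a s s] 1[OF cont(2)] 2 by auto
qed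

text \<open>With \<open>\<epsilon> = 1\<close> all odd, with \<open>\<epsilon> = -1\<close> all even normal derivatives of \<open>F\<close> vanish on the imaginary axis;
  \<open>G j\<close> is the \<open>j\<close>-th normal derivative.\<close>

definition parity_jet :: "real \<Rightarrow> (complex \<Rightarrow> complex) \<Rightarrow> bool" where
  "parity_jet \<epsilon> F \<longleftrightarrow> (\<exists>G. (\<forall>z\<in>left_halfplane. G 0 z = F z) \<and> (\<forall>j. smooth_on left_halfplane (G j)) \<and>
     (\<forall>j s w. s \<le> 0 \<longrightarrow>
        ((\<lambda>s. G j (Complex s w)) has_vector_derivative G (Suc j) (Complex s w)) (at s within {..0})) \<and>
     (\<forall>j w. (-1) ^ j \<noteq> \<epsilon> \<longrightarrow> G j (Complex 0 w) = 0))"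

lemma smooth_on_imp_continuous_on: "smooth_on S f \<Longrightarrow> continuous_on S f"
  using smooth_on_imp_Ck[of S f 0] by simp

text \<open>The normal derivative shifts the jet by one place and so switches the parity. For the
  tangential one, differentiate every \<open>G j\<close> along the axis: mixed partials commute, so
  the results \<open>B j\<close> again form a jet, and where \<open>G j\<close> vanishes on the
  whole axis so does \<open>B j\<close>.\<close>

lemma parity_jet_partials:
  assumes P: "parity_jet \<epsilon> F" and F: "has_partials F Fs Fw" and sm: "smooth_on left_halfplane Fs" "smooth_on left_halfplane Fw"
  shows "parity_jet (- \<epsilon>) Fs" "parity_jet \<epsilon> Fw"
proof -
  from P obtain G where G: "\<And>z. z \<in> left_halfplane \<Longrightarrow> G 0 z = F z" "\<And>j. smooth_on left_halfplane (G j)"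
    "\<And>j s w. s \<le> 0 \<Longrightarrow>
        ((\<lambda>s. G j (Complex s w)) has_vector_derivative G (Suc j) (Complex s w)) (at s within {..0})"
    "\<And>j w. (-1) ^ j \<noteq> \<epsilon> \<Longrightarrow> G j (Complex 0 w) = 0"
    unfolding parity_jet_def by blast
  have G1: "G 1 z = Fs z" if "z \<in> left_halfplane" for z
  proof -
    obtain s w where z: "z = Complex s w" "s \<le> 0" using \<open>z \<in> left_halfplane\<close> by (cases z) (auto simp: left_halfplane_def)
    have "((\<lambda>s. G 0 (Complex s w)) has_vector_derivative Fs (Complex s w)) (at s within {..0})"
      by (rule has_vector_derivative_transform[OF _ _ has_partials_has_vector_derivative_Re[OF F]])
        (use z G(1) in \<open>auto simp: left_halfplane_def\<close>)
    from has_vector_derivative_unique_atMost[OF G(3) this] z show ?thesis by simp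
  qed
  show "parity_jet (- \<epsilon>) Fs"
    unfolding parity_jet_def
    by (rule exI[of _ "\<lambda>j. G (Suc j)"]) (use G G1 in auto)
  have "\<forall>j. \<exists>A B. smooth_on left_halfplane A \<and> smooth_on left_halfplane B \<and> has_partials (G j) A B"
    using smooth_on_obtain_partials[OF G(2)] by metis
  then obtain A B where AB: "\<And>j. smooth_on left_halfplane (A j)" "\<And>j. smooth_on left_halfplane (B j)" "\<And>j. has_partials (G j) (A j) (B j)"
    by metis
  have AG: "A j (Complex s w) = G (Suc j) (Complex s w)" if "s \<le> 0" for j s w
    by (rule has_vector_derivative_unique_atMost[OF has_partials_has_vector_derivative_Re[OF AB(3)] G(3)]) (use that in auto)
  have B0: "B 0 z = Fw z" if "z \<in> left_halfplane" for z
  proof -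
    obtain s w where z: "z = Complex s w" "s \<le> 0" using \<open>z \<in> left_halfplane\<close> by (cases z) (auto simp: left_halfplane_def)
    have "(\<lambda>w. F (Complex s w)) = (\<lambda>w. G 0 (Complex s w))" using G(1) z by (auto simp: left_halfplane_def)
    with has_partials_has_vector_derivative_Im[OF F z(2), of w UNIV] has_partials_has_vector_derivative_Im[OF AB(3) z(2), of 0 w UNIV]
    show ?thesis using vector_derivative_unique_at z by metis
  qed
  have Bs: "((\<lambda>s. B j (Complex s w)) has_vector_derivative B (Suc j) (Complex s w)) (at s within {..0})"
    if s: "s \<le> 0" for j s w
  proof -
    obtain As Aw where A: "smooth_on left_halfplane As" "smooth_on left_halfplane Aw" "has_partials (A j) As Aw" using smooth_on_obtain_partials[OF AB(1)] .
    obtain Bs Bw where B: "smooth_on left_halfplane Bs" "smooth_on left_halfplane Bw" "has_partials (B j) Bs Bw" using smooth_on_obtain_partials[OF AB(2)] .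
    have "Aw (Complex s w) = Bs (Complex s w)"
      using mixed_partials_eq[OF AB(3) A(3) B(3) _ _ _ s] smooth_on_imp_continuous_on AB A B by blast
    moreover have "(\<lambda>w. A j (Complex s w)) = (\<lambda>w. G (Suc j) (Complex s w))" using AG s by auto
    then have "Aw (Complex s w) = B (Suc j) (Complex s w)"
      using has_partials_has_vector_derivative_Im[OF A(3) s, of w UNIV] has_partials_has_vector_derivative_Im[OF AB(3) s, of "Suc j" w UNIV]
        vector_derivative_unique_at by metis
    ultimately show ?thesis using has_partials_has_vector_derivative_Re[OF B(3) s, of w] by simp
  qed
  have "B j (Complex 0 w) = 0" if "(-1) ^ j \<noteq> \<epsilon>" for j w
  proof -
    have "(\<lambda>w. G j (Complex 0 w)) = (\<lambda>w. 0)" using G(4)[OF that] by auto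
    with has_partials_has_vector_derivative_Im[OF AB(3), of 0 j w UNIV] vector_derivative_unique_at
      has_vector_derivative_const show ?thesis by (metis order_refl)
  qed
  then show "parity_jet \<epsilon> Fw"
    unfolding parity_jet_def by (intro exI[of _ B]) (use B0 Bs AB in auto)
qed

definition half_reflect :: "real \<Rightarrow> (complex \<Rightarrow> complex) \<Rightarrow> complex \<Rightarrow> complex" where
  "half_reflect \<epsilon> F z = (if Re z \<le> 0 then F z else \<epsilon> *\<^sub>R F (- cnj z))"

text \<open>On the axis itself the two branches have to agree. For \<open>\<epsilon> = -1\<close>
  this holds because the jet makes \<open>F\<close> vanish there.\<close>

lemma half_reflect_right:
  assumes "parity_jet \<epsilon> F" "Re z \<ge> 0" "\<epsilon> = 1 \<or> \<epsilon> = -1"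
  shows "half_reflect \<epsilon> F z = \<epsilon> *\<^sub>R F (- cnj z)"
proof (cases "Re z = 0")
  case True
  then have z: "- cnj z = z" "z = Complex 0 (Im z)" by (auto simp: complex_eq_iff)
  have "F z = 0" if "\<epsilon> = -1"
  proof -
    from assms(1) obtain G where "\<forall>z\<in>left_halfplane. G 0 z = F z" "\<forall>j w. (-1) ^ j \<noteq> \<epsilon> \<longrightarrow> G j (Complex 0 w) = 0"
      unfolding parity_jet_def by blast
    then have "G 0 z = F z" "G 0 (Complex 0 (Im z)) = 0" using that True by (auto simp: left_halfplane_def)
    then show ?thesis using z(2) by simp
  qed
  then show ?thesis using assms(3) z(1) True by (auto simp: half_reflect_def)
next
  case False
  then show ?thesis using assms by (auto simp: half_reflect_def)
qed

lemma has_derivative_within_union: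
  assumes "(f has_derivative L) (at z within A)" "(f has_derivative L) (at z within B)"
  shows "(f has_derivative L) (at z within A \<union> B)"
  using assms by (auto simp: has_derivative_within Lim_within_Un)

text \<open>Away from a closed set the filter is trivial. This allows the two halves of the plane to
  be treated at every point alike before they are glued.\<close>

lemma has_derivative_within_notin_closed:
  assumes "bounded_linear L" "closed A" "z \<notin> A"
  shows "(f has_derivative L) (at z within A)"
proof -
  have "at z within A = bot"
    using assms by (simp add: at_within_eq_bot_iff)
  then show ?thesis unfolding has_derivative_within using assms(1) by simp
qed

text \<open>The partials of a reflected function are reflected functions: that of \<open>Fs\<close>
  with sign \<open>-\<epsilon>\<close> and that of \<open>Fw\<close> with sign
  \<open>\<epsilon>\<close>. The coinduction therefore runs over all admissible pairs of a sign and
  a function. At the axis the one-sided derivatives agree by the parity of the partials.\<close>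

lemma smooth_on_half_reflect:
  assumes "smooth_on left_halfplane F" "parity_jet \<epsilon> F" "\<epsilon> = 1 \<or> \<epsilon> = -1"
  shows "smooth_on UNIV (half_reflect \<epsilon> F)"
proof -
  define f where "f = half_reflect \<epsilon> F"
  have "\<exists>\<epsilon> F. f = half_reflect \<epsilon> F \<and> smooth_on left_halfplane F \<and> parity_jet \<epsilon> F \<and> (\<epsilon> = 1 \<or> \<epsilon> = -1)"
    using assms f_def by blast
  then have "smooth_on UNIV f"
  proof (coinduction arbitrary: f)
    case (smooth_on f)
    then obtain \<epsilon> F where f: "f = half_reflect \<epsilon> F" and F: "smooth_on left_halfplane F" "parity_jet \<epsilon> F" and \<epsilon>: "\<epsilon> = 1 \<or> \<epsilon> = -1"
      by blast
    obtain Fs Fw where Fp: "smooth_on left_halfplane Fs" "smooth_on left_halfplane Fw" "has_partials F Fs Fw" using smooth_on_obtain_partials[OF F(1)] .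
    note P = parity_jet_partials[OF F(2) Fp(3) Fp(1,2)]
    define D where "D = (\<lambda>i::complex. if i = 1 then half_reflect (-\<epsilon>) Fs else half_reflect \<epsilon> Fw)"
    have Ds: "(\<lambda>h. \<Sum>i\<in>Basis. (h \<bullet> i) *\<^sub>R D i z) =
      (\<lambda>h. Re h *\<^sub>R half_reflect (-\<epsilon>) Fs z + Im h *\<^sub>R half_reflect \<epsilon> Fw z)" for z
      by (auto simp: D_def Basis_complex_def inner_complex_def complex_eq_iff)
    have "(f has_derivative (\<lambda>h. Re h *\<^sub>R half_reflect (-\<epsilon>) Fs z + Im h *\<^sub>R half_reflect \<epsilon> Fw z)) (at z)"
      (is "(f has_derivative ?L) _") for z
    proof -
      have bl: "bounded_linear ?L" by (intro bounded_linear_intros bounded_linear_Re bounded_linear_Im)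
      let ?HR = "{z. Re z \<ge> 0}"
      have 1: "(f has_derivative ?L) (at z within left_halfplane)"
      proof (cases "z \<in> left_halfplane")
        case True
        then have "(F has_derivative ?L) (at z within left_halfplane)"
          using Fp(3) by (auto simp: has_partials_def left_halfplane_def half_reflect_def)
        then show ?thesis
          by (rule has_derivative_transform[OF True, rotated]) (auto simp: f half_reflect_def left_halfplane_def)
      next
        case False
        then show ?thesis using bl unfolding left_halfplane_def
          by (intro has_derivative_within_notin_closed) (auto intro: closed_halfspace_Re_le)
      qed
      have 2: "(f has_derivative ?L) (at z within ?HR)"
      proof (cases "Re z \<ge> 0")
        case True
        have "((\<lambda>z. - cnj z) has_derivative (\<lambda>h. - cnj h)) (at z within ?HR)"
          by (auto intro!: derivative_eq_intros)
        moreover have "(F has_derivative (\<lambda>h. Re h *\<^sub>R Fs (- cnj z) + Im h *\<^sub>R Fw (- cnj z))) (at (- cnj z) within (\<lambda>z. - cnj z) ` ?HR)"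
          using Fp(3) True by - (rule has_derivative_subset[of F _ _ left_halfplane]; auto simp: has_partials_def left_halfplane_def)
        ultimately have "((\<lambda>z. F (- cnj z)) has_derivative (\<lambda>h. Re (- cnj h) *\<^sub>R Fs (- cnj z) + Im (- cnj h) *\<^sub>R Fw (- cnj z))) (at z within ?HR)"
          by (rule has_derivative_in_compose)
        then have "((\<lambda>z. \<epsilon> *\<^sub>R F (- cnj z)) has_derivative (\<lambda>h. \<epsilon> *\<^sub>R (Re (- cnj h) *\<^sub>R Fs (- cnj z) + Im (- cnj h) *\<^sub>R Fw (- cnj z)))) (at z within ?HR)"
          by (rule has_derivative_scaleR_right)
        moreover have "(\<lambda>h. \<epsilon> *\<^sub>R (Re (- cnj h) *\<^sub>R Fs (- cnj z) + Im (- cnj h) *\<^sub>R Fw (- cnj z))) = ?L"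
          using half_reflect_right[OF P(1) True] half_reflect_right[OF P(2) True] \<epsilon>
          by (auto simp: complex_eq_iff algebra_simps)
        ultimately have "((\<lambda>z. \<epsilon> *\<^sub>R F (- cnj z)) has_derivative ?L) (at z within ?HR)" by simp
        then show ?thesis
          by (rule has_derivative_transform[rotated 2]) (use True \<epsilon> half_reflect_right[OF F(2)] f in auto)
      next
        case False
        then show ?thesis using bl
          by (intro has_derivative_within_notin_closed) (auto intro: closed_halfspace_Re_ge)
      qed
      have "left_halfplane \<union> ?HR = UNIV" by (auto simp: left_halfplane_def)
      then show ?thesis using has_derivative_within_union[OF 1 2] by simp
    qed
    moreover have "\<exists>\<epsilon>' F'. D i = half_reflect \<epsilon>' F' \<and> smooth_on left_halfplane F' \<and> parity_jet \<epsilon>' F' \<and> (\<epsilon>' = 1 \<or> \<epsilon>' = -1)" for i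
    proof (cases "i = 1")
      case True
      then show ?thesis using \<epsilon> P Fp by (intro exI[of _ "-\<epsilon>"] exI[of _ Fs]) (auto simp: D_def)
    next
      case False
      then show ?thesis using \<epsilon> P Fp by (intro exI[of _ "\<epsilon>"] exI[of _ Fw]) (auto simp: D_def)
    qed
    ultimately show ?case
      unfolding Ds[symmetric] by (intro exI[of _ UNIV] exI[of _ f] exI[of _ D]) simp
  qed
  then show ?thesis unfolding f_def .
qed

subsection \<open>Even Taylor expansions\<close>

text \<open>Induction on the order, applied to the derivative \<open>h 1\<close>. For complex values
  the mean value inequality takes the place of l'Hospital's rule.\<close>

lemma tendsto_taylor_quotient:
  fixes h :: "nat \<Rightarrow> real \<Rightarrow> complex"
  assumes "\<And>i t. t \<ge> 0 \<Longrightarrow> (h i has_vector_derivative h (Suc i) t) (at t within {0..})"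
    and "\<And>i. i < j \<Longrightarrow> h i 0 = 0"
  shows "((\<lambda>t. h 0 t / of_real t ^ j) \<longlongrightarrow> h j 0 / fact j) (at_right 0)"
  using assms
proof (induction j arbitrary: h)
  case 0
  have "continuous (at 0 within {0..}) (h 0)"
    using 0(1)[of 0 0] by (auto intro: has_vector_derivative_continuous)
  then have "(h 0 \<longlongrightarrow> h 0 0) (at 0 within {0..})" by (simp add: continuous_within)
  then have "(h 0 \<longlongrightarrow> h 0 0) (at_right 0)" by (rule tendsto_within_subset) auto
  then show ?case by simp
next
  case (Suc j)
  define c where "c = h (Suc j) 0 / fact j"
  have IH: "((\<lambda>t. h 1 t / of_real t ^ j) \<longlongrightarrow> c) (at_right 0)"
    using Suc.IH[of "\<lambda>i. h (Suc i)"] Suc.prems by (simp add: c_def)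
  have "((\<lambda>t. h 0 t / of_real t ^ Suc j) \<longlongrightarrow> c / of_nat (Suc j)) (at_right 0)"
    unfolding tendsto_iff
  proof (intro allI impI)
    fix e :: real assume e: "e > 0"
    then have "\<forall>\<^sub>F t in at_right 0. dist (h 1 t / of_real t ^ j) c < e / 2" by (intro tendstoD[OF IH]) simp
    then obtain d where d: "d > 0" "\<And>t. 0 < t \<Longrightarrow> t < d \<Longrightarrow> dist (h 1 t / of_real t ^ j) c < e / 2"
      unfolding eventually_at_right_field by auto
    have "dist (h 0 t / of_real t ^ Suc j) (c / of_nat (Suc j)) < e" if t: "0 < t" "t < d" for t
    proof -
      \<comment> \<open>\<open>k\<close> is \<open>h 0\<close> minus its expected leading term, and
        \<open>\<phi>\<close> is a real majorant: its derivative dominates the norm of that of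
        \<open>k\<close> by the induction hypothesis.\<close>
      define k where "k = (\<lambda>x. h 0 x - c * of_real (x ^ Suc j) / of_nat (Suc j))"
      define \<phi> where "\<phi> = (\<lambda>x::real. e / 2 * x ^ Suc j / of_nat (Suc j))"
      have k': "(k has_vector_derivative (h 1 x - c * of_real (x ^ j))) (at x within {0..})" if "x \<ge> 0" for x
      proof -
        have "((\<lambda>x. x ^ Suc j) has_real_derivative of_nat (Suc j) * x ^ j) (at x within {0..})"
          by (auto intro!: derivative_eq_intros simp del: power_Suc)
        from has_vector_derivative_mult_right[OF has_vector_derivative_of_real[OF this], of "c / of_nat (Suc j)"]
        have "((\<lambda>x. c * of_real (x ^ Suc j) / of_nat (Suc j)) has_vector_derivative c * of_real (x ^ j)) (at x within {0..})"
          by (simp add: field_simps del: power_Suc of_nat_Suc)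
        from has_vector_derivative_diff[OF Suc.prems(1)[OF that, of 0] this] show ?thesis
          by (simp add: k_def)
      qed
      have "norm (k t - k 0) \<le> \<phi> t - \<phi> 0"
      proof (rule differentiable_bound_general[OF t(1), where f' = "\<lambda>x. h 1 x - c * of_real (x ^ j)" and \<phi>' = "\<lambda>x. e / 2 * x ^ j"])
        show "continuous_on {0..t} k"
          by (rule continuous_on_subset[of "{0..}"])
            (use k' in \<open>auto intro: has_vector_derivative_continuous simp: continuous_on_eq_continuous_within\<close>)
        show "continuous_on {0..t} \<phi>" unfolding \<phi>_def by (intro continuous_intros) auto
        fix x assume x: "0 < x" "x < t"
        have "at x within {0..} = at x" by (rule at_within_open_subset[of _ "{0<..}"]) (use x in auto)
        then show "(k has_vector_derivative (h 1 x - c * of_real (x ^ j))) (at x)" using k'[of x] x by simp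
        have "((\<lambda>x. x ^ Suc j) has_real_derivative of_nat (Suc j) * x ^ j) (at x)"
          by (auto intro!: derivative_eq_intros simp del: power_Suc)
        from DERIV_cmult[OF this, of "e / 2 / of_nat (Suc j)"]
        have "(\<phi> has_real_derivative e / 2 * x ^ j) (at x)"
          by (simp add: \<phi>_def del: power_Suc of_nat_Suc)
        then show "(\<phi> has_vector_derivative e / 2 * x ^ j) (at x)"
          by (simp add: has_real_derivative_iff_has_vector_derivative)
        have "h 1 x - c * of_real (x ^ j) = (h 1 x / of_real x ^ j - c) * of_real (x ^ j)" using x by (simp add: field_simps)
        then have "norm (h 1 x - c * of_real (x ^ j)) = norm (h 1 x / of_real x ^ j - c) * x ^ j"
          using x by (simp add: norm_mult norm_power)
        also have "\<dots> \<le> e / 2 * x ^ j" using d(2)[of x] x t by (intro mult_right_mono) (auto simp: dist_norm)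
        finally show "norm (h 1 x - c * of_real (x ^ j)) \<le> e / 2 * x ^ j" .
      qed
      moreover have "k 0 = 0" "\<phi> 0 = 0" using Suc.prems(2)[of 0] by (auto simp: k_def \<phi>_def)
      ultimately have "norm (k t) \<le> e / 2 * t ^ Suc j / of_nat (Suc j)" by (simp add: \<phi>_def)
      also have "\<dots> \<le> e / 2 * t ^ Suc j / 1" using e t by (intro divide_left_mono) auto
      finally have "norm (k t) / t ^ Suc j \<le> e / 2" using t by (simp add: divide_le_eq)
      moreover have "h 0 t / of_real t ^ Suc j - c / of_nat (Suc j) = k t / of_real (t ^ Suc j)"
        using t by (simp add: k_def field_simps del: of_nat_Suc)
      ultimately have "dist (h 0 t / of_real t ^ Suc j) (c / of_nat (Suc j)) \<le> e / 2"
        using t by (simp add: dist_norm norm_divide norm_mult norm_power)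
      then show ?thesis using e by linarith
    qed
    then show "\<forall>\<^sub>F t in at_right 0. dist (h 0 t / of_real t ^ Suc j) (c / of_nat (Suc j)) < e"
      unfolding eventually_at_right_field using d(1) by auto
  qed
  then show ?case by (simp add: c_def field_simps)
qed

text \<open>The first nonzero derivative, of order \<open>j \<le> m\<close>, would give
  \<open>h 0 t / of_real t ^ j\<close> a nonzero limit, while the assumption makes that quotient
  tend to 0.\<close>

lemma derivatives_eq_0_of_little_o:
  fixes h :: "nat \<Rightarrow> real \<Rightarrow> complex"
  assumes h: "\<And>i t. t \<ge> 0 \<Longrightarrow> (h i has_vector_derivative h (Suc i) t) (at t within {0..})"
    and o: "((\<lambda>t. h 0 t / of_real t ^ m) \<longlongrightarrow> 0) (at_right 0)"
  shows "j \<le> m \<Longrightarrow> h j 0 = 0"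
proof (induction j rule: less_induct)
  case (less j)
  have 1: "((\<lambda>t. h 0 t / of_real t ^ j) \<longlongrightarrow> h j 0 / fact j) (at_right 0)"
    by (rule tendsto_taylor_quotient[where h = h]) (use h less in auto)
  have "((\<lambda>t. h 0 t / of_real t ^ m * of_real t ^ (m - j)) \<longlongrightarrow> 0 * of_real 0 ^ (m - j)) (at_right 0)"
    by (intro tendsto_intros o)
  then have "((\<lambda>t. h 0 t / of_real t ^ m * of_real t ^ (m - j)) \<longlongrightarrow> 0) (at_right 0)" by simp
  then have "((\<lambda>t. h 0 t / of_real t ^ j) \<longlongrightarrow> 0) (at_right 0)"
  proof (rule Lim_transform_eventually)
    have "h 0 t / of_real t ^ m * of_real t ^ (m - j) = h 0 t / of_real t ^ j" if "t > 0" for t :: real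
      using that less.prems by (simp add: field_simps flip: power_add)
    then show "\<forall>\<^sub>F t in at_right 0. h 0 t / of_real t ^ m * of_real t ^ (m - j) = h 0 t / of_real t ^ j"
      unfolding eventually_at_right_field by (auto intro!: exI[of _ 1])
  qed
  with 1 have "h j 0 / fact j = 0" using tendsto_unique trivial_limit_at_right_real by blast
  then show ?case by simp
qed

text \<open>Through this a remainder that is small against a power of \<open>tanh t\<close> is also
  small against the same power of \<open>t\<close>.\<close>

lemma tanh_le_self:
  assumes "t \<ge> (0::real)"
  shows "tanh t \<le> t"
proof -
  have "0 - tanh 0 \<le> t - tanh t"
  proof (rule DERIV_nonneg_imp_nondecreasing[OF assms])
    fix x :: real
    have "((\<lambda>x. x - tanh x) has_real_derivative tanh x ^ 2) (at x)"
      by (auto intro!: derivative_eq_intros)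
    then show "\<exists>y. ((\<lambda>x. x - tanh x) has_real_derivative y) (at x) \<and> 0 \<le> y" by (metis zero_le_power2)
  qed
  then show ?thesis by simp
qed

text \<open>The \<open>n\<close>-th derivative of \<open>p (tanh t)\<close> is a polynomial in \<open>tanh t\<close>, because \<open>tanh' = 1 - tanh\<^sup>2\<close>.\<close>

primrec tanh_deriv_poly :: "complex poly \<Rightarrow> nat \<Rightarrow> complex poly" where
  "tanh_deriv_poly p 0 = p"
| "tanh_deriv_poly p (Suc n) = pderiv (tanh_deriv_poly p n) * [:1, 0, -1:]"

lemma has_vector_derivative_poly_tanh:
  fixes p :: "complex poly"
  shows "((\<lambda>t. poly p (of_real (tanh t))) has_vector_derivative poly (pderiv p * [:1, 0, -1:]) (of_real (tanh t))) (at t within S)"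
proof -
  have "(tanh has_real_derivative (1 - tanh t ^ 2)) (at t within S)"
    by (auto intro!: derivative_eq_intros)
  from has_vector_derivative_of_real[OF this]
  have "((\<lambda>t. complex_of_real (tanh t)) has_vector_derivative of_real (1 - tanh t ^ 2)) (at t within S)" .
  from field_vector_diff_chain_within[OF this, of "poly p" "poly (pderiv p) (of_real (tanh t))"]
  show ?thesis by (simp add: o_def algebra_simps power2_eq_square has_field_derivative_at_within poly_DERIV)
qed

text \<open>\<open>pderiv\<close> switches the parity of a polynomial, and the factor
  \<open>[:1, 0, -1:]\<close> is even. Composition with \<open>[:0, -1:]\<close> is the substitution
  of \<open>-X\<close>, so for even \<open>p\<close> the polynomials of odd index vanish at
  0.\<close>

lemma tanh_deriv_poly_parity:
  assumes "pcompose p [:0, -1:] = p"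
  shows "pcompose (tanh_deriv_poly p n) [:0, -1:] = smult ((-1) ^ n) (tanh_deriv_poly p n)"
proof (induction n)
  case (Suc n)
  let ?q = "tanh_deriv_poly p n"
  from arg_cong[OF Suc, of pderiv]
  have "- pcompose (pderiv ?q) [:0, -1:] = smult ((-1) ^ n) (pderiv ?q)"
    by (simp add: pderiv_pcompose pderiv_smult pderiv_pCons)
  then have *: "pcompose (pderiv ?q) [:0, -1:] = smult ((-1) ^ Suc n) (pderiv ?q)"
    by (metis minus_minus mult_minus1 power_Suc smult_minus_left)
  have "pcompose [:1, 0, -1:] [:0, -1:] = ([:1, 0, -1:] :: complex poly)" by (simp add: pcompose_pCons)
  then show ?case unfolding tanh_deriv_poly.simps pcompose_mult * by (metis mult_smult_left)
qed (use assms in simp)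

lemma smooth_on_comp_exp:
  assumes "smooth_on DH g"
  shows "smooth_on left_halfplane (\<lambda>z. g (exp z))"
proof (rule Ck_imp_smooth_on)
  show "Ck n left_halfplane (\<lambda>z. g (exp z))" for n
    by (rule Ck_compose[OF smooth_on_imp_Ck[OF assms] Ck_exp]) (auto simp: left_halfplane_def DH_def)
  show "\<exists>d. 0 < \<bar>d\<bar> \<and> \<bar>d\<bar> < e \<and> x + d *\<^sub>R i \<in> left_halfplane" if "x \<in> left_halfplane" "i \<in> Basis" "0 < e" for x i e
    using that by (intro exI[of _ "- e/2"]) (auto simp: left_halfplane_def Basis_complex_def)
qed

text \<open>In logarithmic polar coordinates \<open>z = exp (s + i w)\<close> the boundary defining function is \<open>x = - tanh s\<close>,
  so an even expansion in \<open>x\<close> is an even expansion in \<open>s\<close>.\<close>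

lemma parity_jet_Cev:
  assumes g: "g \<in> Cev"
  shows "parity_jet 1 (\<lambda>z. g (exp z))"
proof -
  let ?F = "\<lambda>z. g (exp z)"
  have F: "smooth_on left_halfplane ?F" using g by (auto simp: Cev_def intro: smooth_on_comp_exp)
  \<comment> \<open>The normal derivatives of all orders are chosen successively, as smoothness only
    asserts that each next one exists.\<close>
  have "\<exists>G. \<forall>n. (smooth_on left_halfplane (G n) \<and> (n = 0 \<longrightarrow> G n = ?F)) \<and> (\<exists>B. has_partials (G n) (G (Suc n)) B)"
  proof (rule dependent_nat_choice)
    show "\<exists>x. smooth_on left_halfplane x \<and> (0 = (0::nat) \<longrightarrow> x = ?F)" using F by blast
    show "\<exists>y. (smooth_on left_halfplane y \<and> (Suc n = 0 \<longrightarrow> y = ?F)) \<and> (\<exists>B. has_partials x y B)"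
      if "smooth_on left_halfplane x \<and> (n = 0 \<longrightarrow> x = ?F)" for x n
      using that smooth_on_obtain_partials[of x] by (metis nat.distinct(1))
  qed
  then obtain G where G: "\<And>n. smooth_on left_halfplane (G n)" "G 0 = ?F" "\<And>n. \<exists>B. has_partials (G n) (G (Suc n)) B" by blast
  have Gs: "((\<lambda>s. G j (Complex s w)) has_vector_derivative G (Suc j) (Complex s w)) (at s within {..0})"
    if "s \<le> 0" for j s w using G(3)[of j] has_partials_has_vector_derivative_Re that by blast
  have "G m (Complex 0 w) = 0" if m: "(-1) ^ m \<noteq> (1::real)" for m w
  proof -
    have odd: "odd m" using m by auto
    obtain a where a: "\<And>j. odd j \<Longrightarrow> a j = 0"
      "((\<lambda>x. (g (z_of_xw x w) - (\<Sum>j\<le>m. a j * complex_of_real x ^ j)) / complex_of_real x ^ m) \<longlongrightarrow> 0) (at_right 0)"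
      using g unfolding Cev_def by blast
    \<comment> \<open>The coefficients \<open>a\<close> depend on \<open>w\<close> and on the order
      \<open>m\<close>; they serve for the \<open>m\<close>-th derivative at this one
      \<open>w\<close>.\<close>
    define p where "p = (\<Sum>j\<le>m. monom (a j) j)"
    have p: "poly p x = (\<Sum>j\<le>m. a j * x ^ j)" for x by (simp add: p_def poly_sum poly_monom)
    have pe: "pcompose p [:0, -1:] = p"
    proof -
      have "poly (pcompose p [:0, -1:]) x = poly p x" for x
        unfolding poly_pcompose p using a(1) by (intro sum.cong) (auto simp: minus_one_power_iff power_minus')
      then show ?thesis by (auto simp: poly_eq_poly_eq_iff[symmetric])
    qed
    define q where "q = tanh_deriv_poly p"
    \<comment> \<open>\<open>h j\<close> is the \<open>j\<close>-th derivative in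
      \<open>t = - s\<close> of the difference between \<open>g\<close> and its even Taylor
      polynomial at \<open>x = tanh t\<close>; the sign comes from \<open>s = - t\<close>. Since
      \<open>h m 0 = 0\<close> for this odd \<open>m\<close>, the derivative of \<open>g\<close>
      equals, up to sign, that of the polynomial, which is 0.\<close>
    define h where "h = (\<lambda>j t. (-1) ^ j * G j (Complex (- t) w) - poly (q j) (of_real (tanh t)))"
    have "h m 0 = 0"
    proof (rule derivatives_eq_0_of_little_o[of h m m])
      fix i and t :: real assume t: "t \<ge> 0"
      have 1: "((\<lambda>t. - t) has_vector_derivative - 1) (at t within {0..})"
        by (auto intro!: derivative_eq_intros)
      have 2: "((\<lambda>s. G i (Complex s w)) has_vector_derivative G (Suc i) (Complex (- t) w)) (at (- t) within uminus ` {0..})"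
        by (rule has_vector_derivative_within_subset[OF Gs]) (use t in auto)
      have "((\<lambda>t. G i (Complex (- t) w)) has_vector_derivative - G (Suc i) (Complex (- t) w)) (at t within {0..})"
        using vector_diff_chain_within[OF 1 2] by (simp add: o_def)
      from has_vector_derivative_diff[OF has_vector_derivative_mult_right[OF this, of "(-1) ^ i"]
          has_vector_derivative_poly_tanh[of "q i" t "{0..}"]]
      show "(h i has_vector_derivative h (Suc i) t) (at t within {0..})" by (simp add: h_def q_def)
    next
      have h0: "h 0 t = g (z_of_xw (tanh t) w) - (\<Sum>j\<le>m. a j * complex_of_real (tanh t) ^ j)" if "t > 0" for t
      proof -
        have "(1 - tanh t) / (1 + tanh t) = (exp (- t)) ^ 2"
        proof -
          have "tanh t = (exp t - inverse (exp t)) / (exp t + inverse (exp t))" by (simp add: tanh_altdef exp_minus)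
          moreover have "exp t + inverse (exp t) \<noteq> 0" by (smt (verit) exp_gt_zero positive_imp_inverse_positive)
          ultimately have "tanh t * (exp t * exp t + 1) = exp t * exp t - 1" by (simp add: divide_simps)
          moreover have "1 + tanh t \<noteq> 0" using tanh_real_gt_neg1[of t] by linarith
          ultimately show ?thesis by (simp add: exp_minus divide_simps power2_eq_square algebra_simps)
        qed
        then have "z_of_xw (tanh t) w = exp (Complex (- t) w)"
          by (simp add: z_of_xw_def exp_eq_polar exp_of_real)
        then show ?thesis by (simp add: h_def G(2) q_def p)
      qed
      have lim: "filterlim tanh (at_right 0) (at_right (0::real))"
      proof -
        have "isCont tanh (0::real)" by (intro continuous_intros) auto
        then have "(tanh \<longlongrightarrow> (0::real)) (at_right 0)" by (auto simp: isCont_def intro: tendsto_within_subset)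
        moreover have "\<forall>\<^sub>F t in at_right 0. tanh t > (0::real)"
          unfolding eventually_at_right_field by (auto intro!: exI[of _ 1])
        ultimately show ?thesis unfolding filterlim_at by (auto elim: eventually_mono)
      qed
      note lim2 = filterlim_compose[OF a(2) lim]
      show "((\<lambda>t. h 0 t / of_real t ^ m) \<longlongrightarrow> 0) (at_right 0)"
      proof (rule Lim_null_comparison[OF _ tendsto_norm_zero[OF lim2]])
        have "norm (h 0 t / of_real t ^ m) \<le> norm ((g (z_of_xw (tanh t) w) - (\<Sum>j\<le>m. a j * complex_of_real (tanh t) ^ j)) / complex_of_real (tanh t) ^ m)"
          if t: "t > 0" for t
        proof -
          have "tanh t \<le> t" using t by (intro tanh_le_self) simp
          then have "tanh t ^ m \<le> t ^ m" "tanh t ^ m > 0" using t by (auto intro: power_mono)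
          then show ?thesis unfolding h0[OF t] norm_divide using t
            by (auto simp: norm_power intro!: divide_left_mono mult_pos_pos)
        qed
        then show "\<forall>\<^sub>F t in at_right 0. norm (h 0 t / of_real t ^ m) \<le> norm ((g (z_of_xw (tanh t) w) - (\<Sum>j\<le>m. a j * complex_of_real (tanh t) ^ j)) / complex_of_real (tanh t) ^ m)"
          unfolding eventually_at_right_field by (auto intro!: exI[of _ 1])
      qed
    qed simp
    moreover have "poly (q m) 0 = 0"
    proof -
      have "poly (pcompose (q m) [:0, -1:]) 0 = - poly (q m) 0"
        unfolding q_def tanh_deriv_poly_parity[OF pe] using odd by simp
      then show ?thesis by (simp add: poly_pcompose)
    qed
    ultimately show ?thesis by (simp add: h_def)
  qed
  then show ?thesis unfolding parity_jet_def using G Gs by (intro exI[of _ G]) auto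
qed

subsection \<open>Geodesics and inversion\<close>

definition circle_reflect :: "(complex \<Rightarrow> complex) \<Rightarrow> complex \<Rightarrow> complex" where
  "circle_reflect g z = (if cmod z \<le> 1 then g z else g (1 / cnj z))"

text \<open>At \<open>z = 0\<close> the convention \<open>1 / 0 = 0\<close> makes 0 its own inverse
  point, so 0 also stands for infinity and carries the right value \<open>g 0\<close>.\<close>

lemma circle_reflect_inversion: "circle_reflect g (1 / cnj z) = circle_reflect g z"
proof (cases "cmod z = 1")
  case True
  then have "z * cnj z = 1" by (simp add: complex_norm_square[symmetric])
  then have "1 / cnj z = z" by (metis mult_cancel_right divide_eq_eq mult_zero_right zero_neq_one)
  then show ?thesis by simp
next
  case False
  then show ?thesis
    by (cases "z = 0") (auto simp: circle_reflect_def norm_divide divide_simps not_le)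
qed

text \<open>In the logarithmic coordinate, inversion in the circle is reflection in the imaginary
  axis; the points 0 and infinity are out of its range.\<close>

lemma circle_reflect_exp: "circle_reflect g (exp \<zeta>) = half_reflect 1 (\<lambda>z. g (exp z)) \<zeta>"
  by (auto simp: circle_reflect_def half_reflect_def exp_cnj exp_minus inverse_eq_divide)

lemma smooth_on_circle_reflect_exp:
  assumes "g \<in> Cev"
  shows "smooth_on UNIV (\<lambda>\<zeta>. circle_reflect g (exp \<zeta>))"
  unfolding circle_reflect_exp
  using smooth_on_half_reflect[OF _ parity_jet_Cev[OF assms]] assms smooth_on_comp_exp
  by (auto simp: Cev_def)

text \<open>At \<open>v = 0\<close> and \<open>v = 1\<close> this gives the ideal end points of the
  geodesic, at the angles \<open>\<beta>\<close> and \<open>\<beta> + pi + 2 * \<alpha>\<close>.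
  Including them makes the parameter interval compact.\<close>

definition geodZ :: "real \<times> real \<Rightarrow> real \<Rightarrow> complex" where
  "geodZ p v = cis (fst p) * ((1 - of_real v) - of_real v * cis (snd p)) /
     ((1 - of_real v) + of_real v * cis (- snd p))"

text \<open>\<open>SEA\<close> exchanges the two ideal end points, so the same curve is run through
  backwards. Algebraically, a factor \<open>c\<close> is moved from the numerator to the
  denominator.\<close>

lemma geodZ_SEA: "geodZ (SEA p) v = geodZ p (1 - v)"
proof -
  define b c V where "b = cis (fst p)" and "c = cis (snd p)" and "V = complex_of_real v"
  have c: "c \<noteq> 0" "cis (- snd p) = 1 / c" by (auto simp: c_def cis_inverse[symmetric] inverse_eq_divide)
  have "cis (fst p + pi + 2 * snd p) = - b * c * c"
    unfolding b_def c_def mult_2 cis_mult[symmetric] by simp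
  then have "geodZ (SEA p) v = (- b * c * c) * ((1 - V) - V * (1 / c)) / ((1 - V) + V * c)"
    using c(2) by (simp add: geodZ_def SEA_def c_def V_def)
  also have "(- b * c * c) * ((1 - V) - V * (1 / c)) = b * (V - (1 - V) * c) * c"
    using c(1) by (simp add: field_simps)
  also have "b * (V - (1 - V) * c) * c / ((1 - V) + V * c) = b * (V - (1 - V) * c) / (((1 - V) + V * c) / c)"
    by simp
  also have "((1 - V) + V * c) / c = V + (1 - V) * (1 / c)" using c(1) by (simp add: field_simps)
  finally show ?thesis using c(2) by (simp add: geodZ_def b_def c_def V_def)
qed

text \<open>Conjugation inverts \<open>b\<close> and \<open>c\<close>, so both sides are the same
  rational expression in \<open>b\<close>, \<open>c\<close> and \<open>V\<close>. Where a numerator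
  or a denominator vanishes, \<open>1 / 0 = 0\<close> makes both sides 0.\<close>

lemma geodZ_SE: "geodZ (SE p) v = 1 / cnj (geodZ p (1 - v))"
proof -
  define b c V where "b = cis (fst p)" and "c = cis (snd p)" and "V = complex_of_real v"
  have c: "c \<noteq> 0" "cis (- snd p) = 1 / c" and b: "b \<noteq> 0"
    by (auto simp: b_def c_def cis_inverse[symmetric] inverse_eq_divide)
  have pc: "cis (pi - snd p) = - 1 / c" "cis (- (pi - snd p)) = - c"
    using c by (auto simp: c_def cis_divide[symmetric])
  have cn: "cnj b = 1 / b" "cnj c = 1 / c" "cnj V = V"
    by (auto simp: b_def c_def V_def cis_cnj cis_inverse[symmetric] inverse_eq_divide)
  have "cis (fst p + pi + 2 * snd p) = - b * c * c"
    unfolding b_def c_def mult_2 cis_mult[symmetric] by simp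
  then have "geodZ (SE p) v = (- b * c * c) * ((1 - V) - V * (- 1 / c)) / ((1 - V) + V * (- c))"
    unfolding geodZ_def SE_def fst_conv snd_conv pc V_def by (simp add: mult.commute)
  also have "(- b * c * c) * ((1 - V) - V * (- 1 / c)) = - b * c * (V + (1 - V) * c)"
    using c(1) by (simp add: field_simps)
  also have "(1 - V) + V * (- c) = - c * (V - (1 - V) * (1 / c))" using c(1) by (simp add: field_simps)
  also have "- b * c * (V + (1 - V) * c) / (- c * (V - (1 - V) * (1 / c))) =
      (V + (1 - V) * c) / (1 / b * (V - (1 - V) * (1 / c)))"
    using c(1) b by simp
  also have "\<dots> = 1 / cnj (b * (V - (1 - V) * c) / (V + (1 - V) * (1 / c)))"
    by (simp add: cn)
  finally show ?thesis using c(2) by (simp add: geodZ_def b_def c_def V_def)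
qed

section \<open>Position and smoothness of the geodesic family\<close>

lemma cmod_geodZ_numerator:
  "(cmod ((1 - of_real v) - of_real v * cis a))\<^sup>2 = (1 - v)\<^sup>2 + v\<^sup>2 - 2 * v * (1 - v) * cos a"
proof -
  have "(cmod ((1 - of_real v) - of_real v * cis a))\<^sup>2 =
    (1 - v)\<^sup>2 + v\<^sup>2 * ((sin a)\<^sup>2 + (cos a)\<^sup>2) - 2 * v * (1 - v) * cos a"
    unfolding cmod_power2
    by (simp add: power2_eq_square algebra_simps del: sin_cos_squared_add sin_cos_squared_add2 sin_cos_squared_add3)
  then show ?thesis by simp
qed

lemma cmod_geodZ_denominator:
  "(cmod ((1 - of_real v) + of_real v * cis (- a)))\<^sup>2 = (1 - v)\<^sup>2 + v\<^sup>2 + 2 * v * (1 - v) * cos a"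
proof -
  have "(cmod ((1 - of_real v) + of_real v * cis (- a)))\<^sup>2 =
    (1 - v)\<^sup>2 + v\<^sup>2 * ((sin a)\<^sup>2 + (cos a)\<^sup>2) + 2 * v * (1 - v) * cos a"
    unfolding cmod_power2
    by (simp add: power2_eq_square algebra_simps del: sin_cos_squared_add sin_cos_squared_add2 sin_cos_squared_add3)
  then show ?thesis by simp
qed

lemma sum_squares_complement_pos: "(1 - v)\<^sup>2 + v\<^sup>2 > (0::real)"
  by (cases "v = 0") (auto intro: add_nonneg_pos)

text \<open>For \<open>cos a > 0\<close> the squared modulus is a sum of nonnegative terms with
  positive first part. For \<open>sin a > 0\<close> the imaginary part \<open>- v * sin a\<close>
  vanishes only at \<open>v = 0\<close>, where the denominator is 1.\<close>

lemma geodZ_denominator_nonzero: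
  assumes "cos a > 0 \<and> v \<in> {0..1} \<or> sin a > 0"
  shows "(1 - of_real v) + of_real v * cis (- a) \<noteq> 0"
  using assms
proof
  assume "cos a > 0 \<and> v \<in> {0..1}"
  then have "2 * v * (1 - v) * cos a \<ge> 0" by auto
  then have "(cmod ((1 - of_real v) + of_real v * cis (- a)))\<^sup>2 > 0"
    unfolding cmod_geodZ_denominator using sum_squares_complement_pos[of v] by linarith
  then show ?thesis by auto
next
  assume "sin a > 0"
  then show ?thesis by (auto simp: complex_eq_iff)
qed

text \<open>The squared moduli of numerator and denominator differ only in the sign of the term with
  \<open>cos\<close>.\<close>

lemma cmod_geodZ_le_1:
  assumes "cos (snd p) > 0" "v \<in> {0..1}"
  shows "cmod (geodZ p v) \<le> 1"
proof -
  let ?A = "(1 - of_real v) - of_real v * cis (snd p)"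
  let ?B = "(1 - of_real v) + of_real v * cis (- snd p)"
  have "2 * v * (1 - v) * cos (snd p) \<ge> 0" using assms by auto
  then have "(cmod ?A)\<^sup>2 \<le> (cmod ?B)\<^sup>2"
    unfolding cmod_geodZ_numerator cmod_geodZ_denominator by linarith
  then have "cmod ?A \<le> cmod ?B" by (rule power2_le_imp_le) simp
  then show ?thesis
    using geodZ_denominator_nonzero[of "snd p" v] assms
    by (simp add: geodZ_def norm_mult norm_divide divide_le_eq_1)
qed

lemma Ck_cis:
  fixes L :: "'a::euclidean_space \<Rightarrow> real"
  assumes "bounded_linear L"
  shows "Ck n S (\<lambda>x. cis (L x))"
proof -
  have "Ck n S (\<lambda>x. exp (\<i> * complex_of_real (L x)))"
    by (rule Ck_compose[OF Ck_exp[of n UNIV]])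
      (auto intro!: Ck_bounded_linear bounded_linear_compose[OF bounded_linear_mult_right]
        bounded_linear_compose[OF bounded_linear_of_real] assms)
  then show ?thesis by (simp add: cis_conv_exp)
qed

lemma Ck_inverse_comp:
  fixes f :: "'a::euclidean_space \<Rightarrow> complex"
  assumes "Ck n S f" "\<And>x. x \<in> S \<Longrightarrow> f x \<noteq> 0"
  shows "Ck n S (\<lambda>x. inverse (f x))"
  by (rule Ck_compose[OF Ck_inverse[of "- {0}"] assms(1)]) (use assms(2) in auto)

lemma Ck_geodZ_factor:
  fixes S :: "((real \<times> real) \<times> real) set"
  assumes "\<And>x. x \<in> S \<Longrightarrow> cos (snd (fst x)) > 0 \<and> snd x \<in> {0..1} \<or> sin (snd (fst x)) > 0"
  shows "Ck n S (\<lambda>x. ((1 - of_real (snd x)) - of_real (snd x) * cis (snd (fst x))) *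
     inverse ((1 - of_real (snd x)) + of_real (snd x) * cis (- snd (fst x))))"
proof -
  have v: "Ck n S (\<lambda>x. complex_of_real (snd x))"
    by (intro Ck_bounded_linear bounded_linear_compose[OF bounded_linear_of_real] bounded_linear_snd)
  show ?thesis
    by (intro Ck_mult Ck_diff Ck_add Ck_inverse_comp v Ck_const Ck_cis bounded_linear_minus
        bounded_linear_compose[OF bounded_linear_snd] bounded_linear_fst)
      (use assms geodZ_denominator_nonzero in blast)
qed

lemma Ck_geodZ_cos_pos:
  assumes g: "smooth_on DH g"
  shows "Ck n ({p. cos (snd p) > 0} \<times> {0..1}) (\<lambda>x. circle_reflect g (geodZ (fst x) (snd x)))"
proof -
  let ?S = "{p :: real \<times> real. cos (snd p) > 0} \<times> {0..1}"
  have "Ck n ?S (\<lambda>x. cis (fst (fst x)) * (((1 - of_real (snd x)) - of_real (snd x) * cis (snd (fst x))) *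
     inverse ((1 - of_real (snd x)) + of_real (snd x) * cis (- snd (fst x)))))"
    by (intro Ck_mult Ck_cis bounded_linear_compose[OF bounded_linear_fst] bounded_linear_fst Ck_geodZ_factor) auto
  then have Z: "Ck n ?S (\<lambda>x. geodZ (fst x) (snd x))"
    by (rule Ck_cong) (simp add: geodZ_def divide_inverse)
  have le: "cmod (geodZ (fst x) (snd x)) \<le> 1" if "x \<in> ?S" for x
    using that cmod_geodZ_le_1 by auto
  have "Ck n ?S (\<lambda>x. g (geodZ (fst x) (snd x)))"
    by (rule Ck_compose[OF smooth_on_imp_Ck[OF g] Z]) (use le in \<open>auto simp: DH_def\<close>)
  then show ?thesis
    by (rule Ck_cong) (use le in \<open>auto simp: circle_reflect_def\<close>)
qed

text \<open>After a rotation depending smoothly on \<open>(\<beta>, \<alpha>)\<close> the curve lies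
  in the right half-plane, where the principal logarithm is smooth. Undoing the rotation gives a
  smooth logarithm of \<open>geodZ\<close>, which can be fed into the reflected function composed
  with \<open>exp\<close>.\<close>

lemma Ck_geodZ_sin_pos:
  assumes g: "g \<in> Cev"
  shows "Ck n ({p. sin (snd p) > 0} \<times> {0..1}) (\<lambda>x. circle_reflect g (geodZ (fst x) (snd x)))"
proof -
  let ?S = "{p :: real \<times> real. sin (snd p) > 0} \<times> {0..1::real}"
  \<comment> \<open>\<open>Y\<close> is \<open>geodZ\<close> rotated by the angle
    \<open>pi / 2 - \<beta> - \<alpha>\<close>. This places the two ideal end points at conjugate
    positions with real part \<open>sin \<alpha>\<close>.\<close>
  define Y where "Y = (\<lambda>x :: (real \<times> real) \<times> real. \<i> * (cis (- snd (fst x)) * (((1 - of_real (snd x)) - of_real (snd x) * cis (snd (fst x))) *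
     inverse ((1 - of_real (snd x)) + of_real (snd x) * cis (- snd (fst x))))))"
  have Y: "Ck n ?S Y" unfolding Y_def
    by (intro Ck_mult Ck_cis Ck_const bounded_linear_minus bounded_linear_compose[OF bounded_linear_snd] bounded_linear_fst Ck_geodZ_factor) auto
  have ReY: "Re (Y x) > 0" if "x \<in> ?S" for x
  proof -
    obtain b a v where x: "x = ((b, a), v)" by (metis surj_pair)
    have a: "sin a > 0" using that x by simp
    define B where "B = (1 - complex_of_real v) + of_real v * cis (- a)"
    have B: "B \<noteq> 0" unfolding B_def using geodZ_denominator_nonzero a by blast
    have "Y x = \<i> * cis (- a) * ((1 - of_real v) - of_real v * cis a) / B"
      by (simp add: Y_def x B_def divide_inverse)
    also have "\<dots> = \<i> * cis (- a) * ((1 - of_real v) - of_real v * cis a) * cnj B / of_real ((cmod B)\<^sup>2)"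
      using B by (simp add: complex_norm_square field_simps del: of_real_power)
    finally have "Re (Y x) = Re (\<i> * cis (- a) * ((1 - of_real v) - of_real v * cis a) * cnj B) / (cmod B)\<^sup>2"
      by (simp only: Re_divide_of_real)
    \<comment> \<open>Here \<open>cnj B\<close> is \<open>(1 - v) + v * cis a\<close>, so its
      product with the numerator is a difference of squares and the mixed terms cancel.\<close>
    also have "\<i> * cis (- a) * ((1 - of_real v) - of_real v * cis a) * cnj B = \<i> * ((1 - of_real v)\<^sup>2 * cis (- a) - (of_real v)\<^sup>2 * cis a)"
    proof -
      have "cis (- a) * cis a = 1" by (simp add: cis_mult)
      then show ?thesis by (simp add: B_def cis_cnj) algebra
    qed
    also have "Re (\<i> * ((1 - of_real v)\<^sup>2 * cis (- a) - (of_real v)\<^sup>2 * cis a)) = ((1 - v)\<^sup>2 + v\<^sup>2) * sin a"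
      by (simp add: power2_eq_square algebra_simps)
    finally show ?thesis using a B sum_squares_complement_pos[of v] by simp
  qed
  have 1: "Ck n ?S (\<lambda>x. Ln (Y x))"
    by (rule Ck_compose[OF Ck_Ln[of "{z. Re z > 0}"] Y]) (use ReY in \<open>auto simp: complex_nonpos_Reals_iff\<close>)
  have 2: "bounded_linear (\<lambda>x :: (real \<times> real) \<times> real. \<i> * complex_of_real (fst (fst x) + snd (fst x)))"
    by (intro bounded_linear_compose[OF bounded_linear_mult_right]
        bounded_linear_compose[OF bounded_linear_of_real] bounded_linear_add
        bounded_linear_compose[OF bounded_linear_fst] bounded_linear_compose[OF bounded_linear_snd] bounded_linear_fst)
  have E: "Ck n ?S (\<lambda>x. Ln (Y x) + (\<i> * of_real (fst (fst x) + snd (fst x)) - \<i> * of_real (pi / 2)))"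
    by (rule Ck_add[OF 1 Ck_diff[OF Ck_bounded_linear[OF 2] Ck_const]])
  have "Ck n ?S (\<lambda>x. circle_reflect g (exp (Ln (Y x) + (\<i> * of_real (fst (fst x) + snd (fst x)) - \<i> * of_real (pi / 2)))))"
    by (rule Ck_compose[OF smooth_on_imp_Ck[OF smooth_on_circle_reflect_exp[OF g]] E]) auto
  then show ?thesis
  proof (rule Ck_cong)
    fix x assume x: "x \<in> ?S"
    then have "Y x \<noteq> 0" using ReY by fastforce
    then have "exp (Ln (Y x) + (\<i> * of_real (fst (fst x) + snd (fst x)) - \<i> * of_real (pi / 2))) =
      Y x * (cis (fst (fst x) + snd (fst x)) / cis (pi / 2))"
      by (simp add: exp_add exp_diff cis_conv_exp del: of_real_add)
    also have "\<dots> = geodZ (fst x) (snd x)"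
    proof -
      let ?A = "(1 - of_real (snd x)) - of_real (snd x) * cis (snd (fst x))"
      let ?B = "inverse ((1 - of_real (snd x)) + of_real (snd x) * cis (- snd (fst x)))"
      have "Y x * (cis (fst (fst x) + snd (fst x)) / cis (pi / 2)) =
        (cis (- snd (fst x)) * cis (snd (fst x))) * (cis (fst (fst x)) * ?A * ?B)"
        unfolding Y_def cis_mult[of "fst (fst x)", symmetric] cis_pi_half
        by (simp only: divide_i mult.assoc mult.left_commute[of "\<i>"]) (simp add: ac_simps)
      also have "cis (- snd (fst x)) * cis (snd (fst x)) = 1" by (simp add: cis_mult)
      also have "1 * (cis (fst (fst x)) * ?A * ?B) = geodZ (fst x) (snd x)" by (simp add: geodZ_def divide_inverse)
      finally show ?thesis .
    qed
    finally show "circle_reflect g (exp (Ln (Y x) + (\<i> * of_real (fst (fst x) + snd (fst x)) - \<i> * of_real (pi / 2)))) =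
      circle_reflect g (geodZ (fst x) (snd x))" by simp
  qed
qed

section \<open>The integration variable and the weight\<close>

definition logistic :: "real \<Rightarrow> real" where "logistic s = 1 / (1 + exp (- s))"

lemma logistic_props: "continuous_on UNIV logistic" "logistic s \<in> {0..1}" "logistic (- s) = 1 - logistic s"
proof -
  have p: "1 + exp x > (0::real)" for x by (simp add: add_pos_pos)
  show "continuous_on UNIV logistic" unfolding logistic_def
    using p by (intro continuous_intros) (auto simp: less_imp_neq[symmetric])
  show "logistic s \<in> {0..1}" using p[of "- s"] by (auto simp: logistic_def)
  show "logistic (- s) = 1 - logistic s" using p[of s] p[of "-s"]
    by (simp add: logistic_def exp_minus divide_simps)
qed

lemma integrable_exp_neg_abs:
  assumes "p > (0::real)"
  shows "integrable lborel (\<lambda>s. exp (- p * \<bar>s\<bar>))"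
proof -
  let ?f = "\<lambda>s. indicator {0..} s *\<^sub>R exp (- p * s)"
  have "(\<lambda>s. exp (- p * s)) absolutely_integrable_on {0..}"
    by (rule nonnegative_absolutely_integrable_1[OF integrable_on_exp_minus_to_infinity[OF assms]]) simp
  then have "integrable lebesgue ?f" by (simp add: set_integrable_def)
  then have 1: "integrable lborel ?f" by (subst (asm) integrable_completion) auto
  then have 2: "integrable lborel (\<lambda>s. ?f (- s))"
    using lborel_integrable_real_affine[of ?f "-1" 0] by simp
  show ?thesis
    \<comment> \<open>The two half-lines overlap at \<open>s = 0\<close>, so the sum is used as a
      bound rather than an equality.\<close>
    by (rule Bochner_Integration.integrable_bound[OF Bochner_Integration.integrable_add[OF 1 2]])
      (auto simp: indicator_def)
qed

text \<open>The weight decays like \<open>exp (- p * \<bar>s\<bar>)\<close>. It is used with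
  \<open>p = 2 + 2 * \<gamma>\<close>, and this is where \<open>\<gamma> > -1\<close>
  enters.\<close>

lemma integrable_sech_powr:
  assumes "p > (0::real)"
  shows "integrable lborel (\<lambda>s. (1 / cosh s) powr p)"
proof (rule Bochner_Integration.integrable_bound)
  show "integrable lborel (\<lambda>s. 2 powr p * exp (- p * \<bar>s\<bar>))"
    using integrable_exp_neg_abs[OF assms] by simp
  have "continuous_on UNIV (\<lambda>s::real. (1 / cosh s) powr p)"
    by (intro continuous_intros) (auto simp: less_imp_neq[symmetric])
  then show "(\<lambda>s. (1 / cosh s) powr p) \<in> borel_measurable lborel"
    using borel_measurable_continuous_onI by auto
  have "(1 / cosh s) powr p \<le> 2 powr p * exp (- p * \<bar>s\<bar>)" for s :: real
  proof -
    have "cosh s = cosh \<bar>s\<bar>" by (cases "s \<ge> 0") auto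
    also have "cosh \<bar>s\<bar> \<ge> exp \<bar>s\<bar> / 2" by (simp add: cosh_def)
    finally have "cosh s \<ge> exp \<bar>s\<bar> / 2" .
    then have "1 / cosh s \<le> 2 * exp (- \<bar>s\<bar>)" by (simp add: exp_minus divide_simps mult.commute)
    then have "(1 / cosh s) powr p \<le> (2 * exp (- \<bar>s\<bar>)) powr p" using assms by (intro powr_mono2) auto
    also have "\<dots> = 2 powr p * exp (- p * \<bar>s\<bar>)" by (simp add: powr_mult exp_powr_real mult.commute)
    finally show ?thesis .
  qed
  then show "AE s in lborel. norm ((1 / cosh s) powr p) \<le> norm (2 powr p * exp (- p * \<bar>s\<bar>))"
    by (auto intro!: AE_I2)
qed

text \<open>The shift \<open>ln (1 + a\<^sup>2) / 2\<close> is \<open>- ln (muH a)\<close>. It puts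
  the point where \<open>xH\<close> is largest at parameter 0, so that the weight becomes
  even.\<close>

lemma geodH_eq_geodZ:
  "geodH \<beta> a t = geodZ (\<beta>, arctan a) (logistic (t + ln (1 + a\<^sup>2) / 2))"
  "xH (geodH \<beta> a t) = muH a / cosh (t + ln (1 + a\<^sup>2) / 2)"
proof -
  define \<mu> E where "\<mu> = muH a" and "E = exp t"
  have a2: "1 + a\<^sup>2 > 0" by (simp add: add_pos_nonneg)
  have \<mu>: "\<mu> > 0" "\<mu>\<^sup>2 * (1 + a\<^sup>2) = 1" using a2 by (auto simp: \<mu>_def muH_def power_divide)
  have E: "E > 0" by (simp add: E_def)
  have es: "exp (t + ln (1 + a\<^sup>2) / 2) = E / \<mu>"
  proof -
    have "exp (ln (1 + a\<^sup>2) / 2) = sqrt (1 + a\<^sup>2)"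
      using a2 by (simp add: ln_sqrt[symmetric])
    then show ?thesis by (simp add: exp_add E_def \<mu>_def muH_def)
  qed
  have lg: "logistic (t + ln (1 + a\<^sup>2) / 2) = E / (\<mu> + E)"
    unfolding logistic_def exp_minus es using \<mu> E by (simp add: field_simps)
  have cosh: "cosh (t + ln (1 + a\<^sup>2) / 2) = (E / \<mu> + \<mu> / E) / 2"
    unfolding cosh_def exp_minus es by simp
  \<comment> \<open>Numerator and denominator of \<open>geodH\<close>, multiplied by
    \<open>E + 1\<close> and divided by \<open>- 2\<close>.\<close>
  define N M where "N = 1 - of_real E * (1 + \<i> * of_real a)" and "M = 1 + of_real E * (1 - \<i> * of_real a)"
  have M0: "M \<noteq> 0" using E by (auto simp: M_def complex_eq_iff)
  have tanh: "tanh (t / 2) = (E - 1) / (E + 1)"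
  proof -
    have "E = exp (t / 2) * exp (t / 2)" by (simp add: E_def flip: exp_add)
    then show ?thesis by (simp add: tanh_altdef exp_minus divide_simps add_eq_0_iff)
  qed
  have gH: "geodH \<beta> a t = cis \<beta> * (N / M)"
  proof -
    define e A where "e = complex_of_real E" and "A = \<i> * complex_of_real a"
    have e1: "e + 1 \<noteq> 0" using E unfolding e_def by (metis add_pos_pos less_irrefl of_real_1 of_real_add of_real_eq_0_iff zero_less_one)
    have n: "(2 + A) * ((e - 1) / (e + 1)) + A = - 2 * N / (e + 1)"
      using e1 by (simp add: N_def A_def[symmetric] e_def[symmetric] divide_simps) (simp add: algebra_simps)
    have d: "A * ((e - 1) / (e + 1)) - 2 + A = - 2 * M / (e + 1)"
      using e1 by (simp add: M_def A_def[symmetric] e_def[symmetric] divide_simps) (simp add: algebra_simps)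
    have "geodH \<beta> a t = cis \<beta> * (((2 + A) * ((e - 1) / (e + 1)) + A) / (A * ((e - 1) / (e + 1)) - 2 + A))"
      by (simp add: geodH_def tanh e_def A_def)
    also have "\<dots> = cis \<beta> * (N / M)" unfolding n d using e1 by simp
    finally show ?thesis .
  qed
  have cis: "cis (arctan a) = of_real \<mu> * (1 + \<i> * of_real a)" "cis (- arctan a) = of_real \<mu> * (1 - \<i> * of_real a)"
    by (auto simp: complex_eq_iff cos_arctan sin_arctan \<mu>_def muH_def)
  have s: "of_real (\<mu> + E) \<noteq> (0::complex)" using \<mu> E by (metis add_pos_pos less_irrefl of_real_eq_0_iff)
  \<comment> \<open>Multiplying by \<open>\<mu> + E\<close> turns \<open>V\<close> into
    \<open>E\<close> and \<open>1 - V\<close> into \<open>\<mu>\<close>; both parts of the fraction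
    in \<open>geodZ\<close> then carry the common factor \<open>\<mu>\<close>.\<close>
  define V where "V = complex_of_real (E / (\<mu> + E))"
  have V: "V * of_real (\<mu> + E) = of_real E" "(1 - V) * of_real (\<mu> + E) = of_real \<mu>"
    using s by (auto simp: V_def field_simps)
  have "((1 - V) - V * cis (arctan a)) * of_real (\<mu> + E) =
      (1 - V) * of_real (\<mu> + E) - V * of_real (\<mu> + E) * cis (arctan a)"
    by (simp add: algebra_simps del: of_real_add)
  also have "\<dots> = of_real \<mu> * N" unfolding V by (simp add: N_def cis algebra_simps)
  finally have n: "((1 - V) - V * cis (arctan a)) * of_real (\<mu> + E) = of_real \<mu> * N" .
  have "((1 - V) + V * cis (- arctan a)) * of_real (\<mu> + E) =
      (1 - V) * of_real (\<mu> + E) + V * of_real (\<mu> + E) * cis (- arctan a)"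
    by (simp add: algebra_simps del: of_real_add)
  also have "\<dots> = of_real \<mu> * M" unfolding V by (simp add: M_def cis algebra_simps)
  finally have d: "((1 - V) + V * cis (- arctan a)) * of_real (\<mu> + E) = of_real \<mu> * M" .
  from n d have "((1 - V) - V * cis (arctan a)) / ((1 - V) + V * cis (- arctan a)) = N / M"
    using s \<mu>(1) by (metis mult_divide_mult_cancel_left mult_divide_mult_cancel_right less_irrefl of_real_eq_0_iff)
  then show "geodH \<beta> a t = geodZ (\<beta>, arctan a) (logistic (t + ln (1 + a\<^sup>2) / 2))"
    unfolding gH lg geodZ_def fst_conv snd_conv V_def by (metis times_divide_eq_right)
  have nn: "(cmod N)\<^sup>2 = (1 - E)\<^sup>2 + (a * E)\<^sup>2" "(cmod M)\<^sup>2 = (1 + E)\<^sup>2 + (a * E)\<^sup>2"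
    unfolding cmod_power2 by (auto simp: N_def M_def power2_eq_square)
  have Mp: "(cmod M)\<^sup>2 > 0" using M0 by simp
  have "xH (geodH \<beta> a t) = ((cmod M)\<^sup>2 - (cmod N)\<^sup>2) / ((cmod M)\<^sup>2 + (cmod N)\<^sup>2)"
    using Mp by (simp add: xH_def gH norm_mult norm_divide power_divide divide_simps)
  also have "\<dots> = 2 * E / (1 + (1 + a\<^sup>2) * E\<^sup>2)"
  proof -
    have "(cmod M)\<^sup>2 - (cmod N)\<^sup>2 = 2 * (2 * E)" "(cmod M)\<^sup>2 + (cmod N)\<^sup>2 = 2 * (1 + (1 + a\<^sup>2) * E\<^sup>2)"
      unfolding nn by (simp_all add: power2_eq_square algebra_simps)
    then show ?thesis by (simp only: mult_divide_mult_cancel_left_if) simp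
  qed
  also have "\<dots> = \<mu> / ((E / \<mu> + \<mu> / E) / 2)"
  proof -
    have k: "E\<^sup>2 + \<mu>\<^sup>2 = \<mu>\<^sup>2 * (1 + (1 + a\<^sup>2) * E\<^sup>2)" using \<mu>(2) by algebra
    have "E * E + \<mu> * \<mu> > 0" using \<mu> E by (simp add: add_pos_pos)
    then have "\<mu> / ((E / \<mu> + \<mu> / E) / 2) = \<mu>\<^sup>2 * (2 * E) / (E\<^sup>2 + \<mu>\<^sup>2)"
      using \<mu>(1) E by (simp add: power2_eq_square divide_simps)
    also have "\<dots> = 2 * E / (1 + (1 + a\<^sup>2) * E\<^sup>2)" unfolding k using \<mu>(1) by simp
    finally show ?thesis ..
  qed
  finally show "xH (geodH \<beta> a t) = muH a / cosh (t + ln (1 + a\<^sup>2) / 2)" unfolding cosh \<mu>_def .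
qed

section \<open>The rescaled transform and the scattering relations\<close>

lemma open_trig_halfspaces:
  "open {p :: real \<times> real. cos (snd p) > 0}" "open {p :: real \<times> real. sin (snd p) > 0}"
  "open {p :: real \<times> real. cos (snd p) < 0}" "open {p :: real \<times> real. sin (snd p) < 0}"
  by (auto intro!: open_Collect_less continuous_intros)

lemma Ck_SE: "Ck n S SE" and Ck_SEA: "Ck n S SEA"
proof -
  define L :: "real \<times> real \<Rightarrow> real \<times> real" where "L = (\<lambda>p. (fst p + 2 * snd p, - snd p))"
  have "bounded_linear L" unfolding L_def
    by (intro bounded_linear_Pair bounded_linear_add bounded_linear_fst bounded_linear_const_mult
        bounded_linear_minus bounded_linear_snd)
  then have L: "Ck n S (\<lambda>p. L p + c)" for c by (intro Ck_add Ck_const Ck_bounded_linear)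
  have eq: "SE = (\<lambda>p. L p + (pi, pi))" "SEA = (\<lambda>p. L p + (pi, 0))"
    by (auto simp: L_def SE_def SEA_def)
  show "Ck n S SE" unfolding eq(1) by (rule L)
  show "Ck n S SEA" unfolding eq(2) by (rule L)
qed

text \<open>At \<open>\<alpha> = arctan a\<close> this is the transform divided by
  \<open>muH a powr (2 + 2 * \<gamma>)\<close>. The same formula makes sense for every real
  \<open>\<alpha>\<close>.\<close>

definition fan_integral :: "real \<Rightarrow> (complex \<Rightarrow> complex) \<Rightarrow> real \<times> real \<Rightarrow> complex" where
  "fan_integral \<gamma> g p = (\<integral>s. ((1 / cosh s) powr (2 + 2 * \<gamma>)) *\<^sub>R circle_reflect g (geodZ p (logistic s)) \<partial>lborel)"

lemma fan_integral_reflect_param: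
  "fan_integral \<gamma> g p = (\<integral>s. ((1 / cosh s) powr (2 + 2 * \<gamma>)) *\<^sub>R circle_reflect g (geodZ p (1 - logistic s)) \<partial>lborel)"
  unfolding fan_integral_def
  by (subst lborel_integral_real_affine[of "-1" _ 0]) (auto simp: logistic_props(3))

lemma fan_integral_SEA: "fan_integral \<gamma> g (SEA p) = fan_integral \<gamma> g p"
  unfolding fan_integral_def[of _ _ "SEA p"] geodZ_SEA fan_integral_reflect_param[of _ _ p] ..

lemma fan_integral_SE: "fan_integral \<gamma> g (SE p) = fan_integral \<gamma> g p"
  unfolding fan_integral_def[of _ _ "SE p"] geodZ_SE circle_reflect_inversion fan_integral_reflect_param[of _ _ p] ..

lemma Ck_fan_integral:
  assumes \<gamma>: "\<gamma> > -1" and g: "g \<in> Cev"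
  shows "Ck n UNIV (fan_integral \<gamma> g)"
proof (rule Ck_UNIV_locally)
  fix p :: "real \<times> real"
  have k: "integrable lborel (\<lambda>s. (1 / cosh s) powr (2 + 2 * \<gamma>))"
    using \<gamma> by (intro integrable_sech_powr) simp
  note I = Ck_parameter_integral[OF k logistic_props(1,2) _ compact_Icc]
  have sm: "smooth_on DH g" using g by (simp add: Cev_def)
  have 1: "Ck n {p. cos (snd p) > 0} (fan_integral \<gamma> g)"
    using I[OF open_trig_halfspaces(1) Ck_geodZ_cos_pos[OF sm, of n]] by (simp add: fan_integral_def[abs_def])
  have 2: "Ck n {p. sin (snd p) > 0} (fan_integral \<gamma> g)"
    using I[OF open_trig_halfspaces(2) Ck_geodZ_sin_pos[OF g, of n]] by (simp add: fan_integral_def[abs_def])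
  \<comment> \<open>\<open>SE\<close> replaces \<open>\<alpha>\<close> by
    \<open>pi - \<alpha>\<close>, which changes the sign of \<open>cos\<close>; \<open>SEA\<close>
    below replaces it by \<open>- \<alpha>\<close>, which changes the sign of
    \<open>sin\<close>.\<close>
  have 3: "Ck n {p. cos (snd p) < 0} (fan_integral \<gamma> g)"
  proof -
    have "Ck n {p. cos (snd p) < 0} (\<lambda>p. fan_integral \<gamma> g (SE p))"
      by (rule Ck_compose[OF 1 Ck_SE]) (auto simp: SE_def)
    then show ?thesis unfolding fan_integral_SE .
  qed
  have 4: "Ck n {p. sin (snd p) < 0} (fan_integral \<gamma> g)"
  proof -
    have "Ck n {p. sin (snd p) < 0} (\<lambda>p. fan_integral \<gamma> g (SEA p))"
      by (rule Ck_compose[OF 2 Ck_SEA]) (auto simp: SEA_def)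
    then show ?thesis unfolding fan_integral_SEA .
  qed
  have "cos (snd p) \<noteq> 0 \<or> sin (snd p) \<noteq> 0" using sin_cos_squared_add[of "snd p"] by force
  then consider "cos (snd p) > 0" | "sin (snd p) > 0" | "cos (snd p) < 0" | "sin (snd p) < 0" by linarith
  then show "\<exists>U. open U \<and> p \<in> U \<and> Ck n U (fan_integral \<gamma> g)"
    using 1 2 3 4 open_trig_halfspaces by cases (metis (mono_tags, lifting) mem_Collect_eq)+
qed

lemma fan_integral_periodic:
  "fan_integral \<gamma> g (\<beta> + 2 * pi, \<alpha>) = fan_integral \<gamma> g (\<beta>, \<alpha>)"
  "fan_integral \<gamma> g (\<beta>, \<alpha> - 2 * pi * of_int k) = fan_integral \<gamma> g (\<beta>, \<alpha>)"
proof -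
  have "cis (\<beta> + 2 * pi) = cis \<beta>" by (simp add: complex_eq_iff)
  then show "fan_integral \<gamma> g (\<beta> + 2 * pi, \<alpha>) = fan_integral \<gamma> g (\<beta>, \<alpha>)"
    by (simp add: fan_integral_def geodZ_def)
  have "cis (2 * pi * of_int k) = 1" using cis_multiple_2pi[of "of_int k"] by simp
  then have c: "cis (\<alpha> - 2 * pi * of_int k) = cis \<alpha>"
    by (simp add: cis_divide[symmetric])
  moreover have "cis (- (\<alpha> - 2 * pi * of_int k)) = cis (- \<alpha>)"
    unfolding cis_cnj[symmetric] c ..
  ultimately show "fan_integral \<gamma> g (\<beta>, \<alpha> - 2 * pi * of_int k) = fan_integral \<gamma> g (\<beta>, \<alpha>)"
    unfolding fan_integral_def geodZ_def snd_conv fst_conv by presburger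
qed

text \<open>Reduction of \<open>\<alpha>\<close> is harmless by periodicity, and on the second
  branch invariance under \<open>SE\<close> gives back the same value. Smoothness of the extension
  is thus smoothness of the integral itself.\<close>

lemma Aplus_fan_integral: "Aplus (fan_integral \<gamma> g) = fan_integral \<gamma> g"
  by (auto simp: Aplus_def Let_def fan_integral_SE alpha_red_def fan_integral_periodic(2))

lemma fan_integral_in_Calpha_plus:
  assumes "\<gamma> > -1" "g \<in> Cev"
  shows "fan_integral \<gamma> g \<in> Calpha_plus"
proof -
  have "smooth_on UNIV (fan_integral \<gamma> g)" by (simp add: smooth_on_UNIV_iff_Ck Ck_fan_integral[OF assms])
  then show ?thesis
    by (auto simp: Calpha_plus_def fan_integral_periodic Aplus_fan_integral fan_integral_SEA
        intro: smooth_on_subset)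
qed

section \<open>Factorisation of the transform\<close>

lemma geodH_integrand_eq:
  "complex_of_real (xH (geodH \<beta> a t) powr (2 + 2 * \<gamma>)) * g (geodH \<beta> a t) =
   of_real (muH a powr (2 + 2 * \<gamma>)) * (((1 / cosh (t + ln (1 + a\<^sup>2) / 2)) powr (2 + 2 * \<gamma>)) *\<^sub>R
     circle_reflect g (geodZ (\<beta>, arctan a) (logistic (t + ln (1 + a\<^sup>2) / 2))))"
proof -
  \<comment> \<open>Since \<open>cos (arctan a) > 0\<close>, the geodesic stays in the disk and
    \<open>circle_reflect g\<close> is \<open>g\<close> along it.\<close>
  have "cmod (geodZ (\<beta>, arctan a) (logistic (t + ln (1 + a\<^sup>2) / 2))) \<le> 1"
    by (rule cmod_geodZ_le_1) (auto simp: cos_arctan add_pos_nonneg logistic_props(2)[simplified])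
  moreover have "(muH a / c) powr (2 + 2 * \<gamma>) = muH a powr (2 + 2 * \<gamma>) * (1 / c) powr (2 + 2 * \<gamma>)" if "c > 0" for c
    using that powr_mult[of "muH a" "1 / c" "2 + 2 * \<gamma>"] by (simp add: muH_def)
  ultimately show ?thesis
    unfolding geodH_eq_geodZ(2) by (simp add: circle_reflect_def geodH_eq_geodZ(1) scaleR_conv_of_real)
qed

lemma integrable_fan_integrand:
  assumes \<gamma>: "\<gamma> > -1" and g: "g \<in> Cev"
  shows "integrable lborel (\<lambda>s. ((1 / cosh s) powr (2 + 2 * \<gamma>)) *\<^sub>R circle_reflect g (geodZ (\<beta>, arctan a) (logistic s)))"
proof -
  have k: "integrable lborel (\<lambda>s. (1 / cosh s) powr (2 + 2 * \<gamma>))"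
    using \<gamma> by (intro integrable_sech_powr) simp
  have "smooth_on DH g" using g by (simp add: Cev_def)
  from Ck_parameter_integral[OF k logistic_props(1,2) open_trig_halfspaces(1) compact_Icc Ck_geodZ_cos_pos[OF this, of 0]]
  show ?thesis by (force simp: cos_arctan add_pos_nonneg)
qed

theorem theorem2p2:
  fixes \<gamma> :: real and g :: "complex \<Rightarrow> complex"
  assumes "\<gamma> > -1"
    and "g \<in> Cev"
  defines "f \<equiv> (\<lambda>z. complex_of_real (xH z powr (2 + 2*\<gamma>)) * g z)"
  shows "(\<forall>\<beta> a. integrable lborel (\<lambda>t. f (geodH \<beta> a t))) \<and>
         (\<exists>h\<in>CalphaG. \<forall>\<beta> a. I0H f \<beta> a = complex_of_real (muH a powr (2*\<gamma> + 2)) * h \<beta> a)"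
proof (intro conjI allI)
  let ?J = "\<lambda>\<beta> a s. ((1 / cosh s) powr (2 + 2 * \<gamma>)) *\<^sub>R circle_reflect g (geodZ (\<beta>, arctan a) (logistic s))"
  \<comment> \<open>The argument is written as \<open>c + 1 * t\<close> to fit the affine change of
    variables.\<close>
  have eq: "f (geodH \<beta> a t) = of_real (muH a powr (2 + 2 * \<gamma>)) * ?J \<beta> a (ln (1 + a\<^sup>2) / 2 + 1 * t)" for \<beta> a t
    unfolding f_def geodH_integrand_eq by (simp add: add.commute)
  show "integrable lborel (\<lambda>t. f (geodH \<beta> a t))" for \<beta> a
    unfolding eq
    by (intro integrable_mult_right lborel_integrable_real_affine integrable_fan_integrand[OF assms(1,2)]) simp
  have "I0H f \<beta> a = complex_of_real (muH a powr (2*\<gamma> + 2)) * fan_integral \<gamma> g (\<beta>, arctan a)" for \<beta> a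
  proof -
    have "I0H f \<beta> a = of_real (muH a powr (2 + 2 * \<gamma>)) * (\<integral>t. ?J \<beta> a (ln (1 + a\<^sup>2) / 2 + 1 * t) \<partial>lborel)"
      unfolding I0H_def eq by (rule integral_mult_right_zero)
    also have "(\<integral>t. ?J \<beta> a (ln (1 + a\<^sup>2) / 2 + 1 * t) \<partial>lborel) = (\<integral>s. ?J \<beta> a s \<partial>lborel)"
      by (subst (2) lborel_integral_real_affine[of 1 _ "ln (1 + a\<^sup>2) / 2"]) simp_all
    finally show ?thesis by (simp add: fan_integral_def add.commute)
  qed
  then show "\<exists>h\<in>CalphaG. \<forall>\<beta> a. I0H f \<beta> a = complex_of_real (muH a powr (2*\<gamma> + 2)) * h \<beta> a"
    using fan_integral_in_Calpha_plus[OF assms(1,2)]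
    by (intro bexI[of _ "\<lambda>\<beta> a. fan_integral \<gamma> g (\<beta>, arctan a)"]) (auto simp: CalphaG_def)
qed

end
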